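(* Let $m,n$ be positive integers, $K=J(2m,-2n)$, $\xi=e^{2\pi\sqrt{-1}/(4mn+1)}$, and for $1\le i\le 2mn$ let $\rho_i\colon\pi_1(E_K)\to\mathrm{SL}_2(\mathbb{C})$ be the irreducible metabelian representation given by \[ \rho_i(x_1)=\begin{bmatrix}\xi^i&0\\0&\xi^{-i}\end{bmatrix},\quad \rho_i(x_2)=\begin{bmatrix}\xi^{2mi}&0\\0&\xi^{-2mi}\end{bmatrix},\quad \rho_i(\mu)=\begin{bmatrix}0&1\\-1&0\end{bmatrix}. \] Let $q_i=\frac{4mn+1}{\gcd(4mn+1,i)}$ and $(\rho_i)_{2N}=\sigma_{2N}\circ\rho_i$. Then for $1\le i\le 2mn$, \[ \lim_{N\to\infty}\frac{\log\Delta_{K,(\rho_i)_{2N}}(t)}{2N}=\frac{1}{2q_i}\log\frac{m^2n^2t^4+(2m^2n^2+4mn+1)t^2+m^2n^2}{(t^2+1)^2}+\frac12\log(t^2+1). \]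
   Context: $J(2m,-2n)$ is the double twist knot (a genus one two-bridge knot) in Hoste--Shanahan's notation. Its exterior $E_K=S^3\setminus N(K)$, with $N(K)$ an open tubular neighbourhood, has fundamental group with the Lin presentation (associated with a genus one free Seifert surface) \[ \pi_1(E_K)=\langle x_1,x_2,\mu\mid \mu x_1^m\mu^{-1}=x_1^mx_2^{-1},\ \mu x_2^{n}x_1\mu^{-1}=x_2^{n}\rangle, \] where $\mu$ is a meridian. The abelianization $\alpha\colon\pi_1(E_K)\to\langle t\rangle$ satisfies $\alpha(x_1)=\alpha(x_2)=1$, $\alpha(\mu)=t$. The $\rho_i$, $1\le i\le 2mn$, represent all irreducible metabelian $\mathrm{SL}_2(\mathbb{C})$-representations of $\pi_1(E_K)$ up to conjugation (metabelian: the commutator subgroup has abelian image). $\sigma_n\colon\mathrm{SL}_2(\mathbb{C})\to\mathrm{SL}_n(\mathbb{C})$ is the $n$-dimensional irreducible representation, given by the action on the space of homogeneous polynomials $p(x,y)$ of degree $n-1$: $A\cdot p(x,y)=p(x',y')$ with $\binom{x'}{y'}=A^{-1}\binom{x}{y}$. Twisted Alexander polynomial: for $\varphi\colon\pi_1(E_K)\to\mathrm{SL}_d(\mathbb{C})$ with $d$ even let $\Phi_\varphi\colon\mathbb{Z}[\pi_1(E_K)]\to M_d(\mathbb{C}[t^{\pm1}])$ be the $\mathbb{Z}$-linear extension of $\gamma\mapsto\alpha(\gamma)\varphi(\gamma)$. With $r_1=\mu x_1^m\mu^{-1}x_2x_1^{-m}$ and $r_2=\mu x_2^{n}x_1\mu^{-1}x_2^{-n}$,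 \[ \Delta_{K,\varphi}(t)=\frac{\det\big(\Phi_\varphi(\partial r_k/\partial x_l)\big)_{1\le k,l\le2}}{\det\Phi_\varphi(1-\mu)}, \] where $\partial r_k/\partial x_l$ are Fox derivatives. *)

theory Defs
  imports
    "HOL-Analysis.Complex_Transcendental"
    "HOL-Library.Poly_Mapping"
    "HOL-Algebra.Elementary_Groups"
    "HOL-Computational_Algebra.Field_as_Ring"
    "HOL-Computational_Algebra.Normalized_Fraction"
    "Jordan_Normal_Form.Determinant"
begin

section \<open>Groups given by generators and relations\<close>

text \<open>A letter \<open>(g, True)\<close> stands for the generator \<open>g\<close>, and \<open>(g, False)\<close> for its inverse.\<close>

type_synonym 'a word = "('a \<times> bool) list"

definition word_inv :: "'a word \<Rightarrow> 'a word" where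
  "word_inv w = map (\<lambda>(g, b). (g, \<not> b)) (rev w)"

definition word_pow :: "'a word \<Rightarrow> nat \<Rightarrow> 'a word" where
  "word_pow w k = concat (replicate k w)"

text \<open>The congruence on words generated by free cancellation and the relations \<open>u = v\<close>,
  \<open>(u, v) \<in> R\<close>. For \<open>R = {}\<close> its classes are the elements of the free group.\<close>

inductive pres_eq :: "('a word \<times> 'a word) set \<Rightarrow> 'a word \<Rightarrow> 'a word \<Rightarrow> bool"
  for R where
  refl: "pres_eq R w w"
| sym: "pres_eq R u v \<Longrightarrow> pres_eq R v u"
| trans: "pres_eq R u v \<Longrightarrow> pres_eq R v w \<Longrightarrow> pres_eq R u w"
| append: "pres_eq R u u' \<Longrightarrow> pres_eq R v v' \<Longrightarrow> pres_eq R (u @ v) (u' @ v')"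
| cancel: "pres_eq R [(g, b), (g, \<not> b)] []"
| relation: "(u, v) \<in> R \<Longrightarrow> pres_eq R u v"

definition word_class :: "('a word \<times> 'a word) set \<Rightarrow> 'a word \<Rightarrow> 'a word set" where
  "word_class R w = {v. pres_eq R w v}"

definition presented_group :: "('a word \<times> 'a word) set \<Rightarrow> 'a word set monoid" where
  "presented_group R =
    \<lparr>carrier = range (word_class R),
     monoid.mult = (\<lambda>A B. {w. \<exists>u\<in>A. \<exists>v\<in>B. pres_eq R (u @ v) w}),
     one = word_class R []\<rparr>"

definition gen_class :: "('a word \<times> 'a word) set \<Rightarrow> 'a \<Rightarrow> 'a word set" where
  "gen_class R g = word_class R [(g, True)]"

primrec word_eval :: "('b, 'c) monoid_scheme \<Rightarrow> ('a \<Rightarrow> 'b) \<Rightarrow> 'a word \<Rightarrow> 'b" where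
  "word_eval G f [] = \<one>\<^bsub>G\<^esub>"
| "word_eval G f (x # w) =
     (if snd x then f (fst x) else inv\<^bsub>G\<^esub> f (fst x)) \<otimes>\<^bsub>G\<^esub> word_eval G f w"

text \<open>The homomorphism sending each generator \<open>g\<close> to \<open>f g\<close>. The choice of a representative is
  immaterial when \<open>f\<close> respects the relations; see \<open>gen_lift_hom\<close> below.\<close>

definition gen_lift :: "('b, 'c) monoid_scheme \<Rightarrow> ('a \<Rightarrow> 'b) \<Rightarrow> 'a word set \<Rightarrow> 'b" where
  "gen_lift G f C = word_eval G f (SOME w. w \<in> C)"

lemma word_class_eq: "word_class R u = word_class R v \<longleftrightarrow> pres_eq R u v"
  unfolding word_class_def by (auto intro: pres_eq.intros)

lemma presented_group_mult:
  "word_class R u \<otimes>\<^bsub>presented_group R\<^esub> word_class R v = word_class R (u @ v)"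
  unfolding presented_group_def word_class_def
  by (auto intro: pres_eq.intros)

lemma word_inv_right: "pres_eq R (w @ word_inv w) []"
proof (induction w)
  case Nil
  then show ?case by (simp add: word_inv_def pres_eq.refl)
next
  case (Cons x w)
  obtain g b where x: "x = (g, b)" by fastforce
  have "pres_eq R ([x] @ (w @ word_inv w) @ [(g, \<not> b)]) ([x] @ [] @ [(g, \<not> b)])"
    by (intro pres_eq.append Cons pres_eq.refl)
  moreover have "pres_eq R ([x] @ [] @ [(g, \<not> b)]) []"
    by (simp add: x pres_eq.cancel)
  moreover have "(x # w) @ word_inv (x # w) = [x] @ (w @ word_inv w) @ [(g, \<not> b)]"
    by (simp add: word_inv_def x)
  ultimately show ?case by (metis pres_eq.trans)
qed

lemma word_inv_word_inv: "word_inv (word_inv w) = w"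
  by (simp add: word_inv_def rev_map o_def case_prod_beta)

lemma word_inv_left: "pres_eq R (word_inv w @ w) []"
  using word_inv_right[of R "word_inv w"] by (simp add: word_inv_word_inv)

lemma group_presented_group: "group (presented_group R)"
proof (rule groupI)
  fix x y z
  assume "x \<in> carrier (presented_group R)" "y \<in> carrier (presented_group R)"
    "z \<in> carrier (presented_group R)"
  then obtain u v w where uvw: "x = word_class R u" "y = word_class R v" "z = word_class R w"
    by (auto simp: presented_group_def)
  show "x \<otimes>\<^bsub>presented_group R\<^esub> y \<otimes>\<^bsub>presented_group R\<^esub> z =
      x \<otimes>\<^bsub>presented_group R\<^esub> (y \<otimes>\<^bsub>presented_group R\<^esub> z)"
    by (simp add: uvw presented_group_mult)
next
  fix x y
  assume "x \<in> carrier (presented_group R)" "y \<in> carrier (presented_group R)"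
  then obtain u v where "x = word_class R u" "y = word_class R v"
    by (auto simp: presented_group_def)
  then have "x \<otimes>\<^bsub>presented_group R\<^esub> y = word_class R (u @ v)"
    by (simp add: presented_group_mult)
  then show "x \<otimes>\<^bsub>presented_group R\<^esub> y \<in> carrier (presented_group R)"
    by (simp add: presented_group_def)
next
  show "\<one>\<^bsub>presented_group R\<^esub> \<in> carrier (presented_group R)"
    by (simp add: presented_group_def)
next
  fix x
  assume "x \<in> carrier (presented_group R)"
  then obtain u where u: "x = word_class R u"
    by (auto simp: presented_group_def)
  have one: "\<one>\<^bsub>presented_group R\<^esub> = word_class R []"
    by (simp add: presented_group_def)
  show "\<one>\<^bsub>presented_group R\<^esub> \<otimes>\<^bsub>presented_group R\<^esub> x = x"
    by (simp add: one u presented_group_mult)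
  have "word_class R (word_inv u) \<otimes>\<^bsub>presented_group R\<^esub> x = \<one>\<^bsub>presented_group R\<^esub>"
    by (simp add: one u presented_group_mult word_class_eq word_inv_left)
  then show "\<exists>y\<in>carrier (presented_group R).
      y \<otimes>\<^bsub>presented_group R\<^esub> x = \<one>\<^bsub>presented_group R\<^esub>"
    by (auto simp: presented_group_def)
qed

lemma word_eval_closed:
  assumes "group G" and "\<And>g. f g \<in> carrier G"
  shows "word_eval G f w \<in> carrier G"
proof -
  interpret group G by fact
  show ?thesis by (induction w) (auto simp: assms(2))
qed

lemma word_eval_append:
  assumes "group G" and "\<And>g. f g \<in> carrier G"
  shows "word_eval G f (u @ v) = word_eval G f u \<otimes>\<^bsub>G\<^esub> word_eval G f v"
proof -
  interpret group G by fact
  show ?thesis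
    by (induction u) (auto simp: assms(2) m_assoc word_eval_closed[OF assms])
qed

lemma word_eval_cong:
  assumes "group G" and "\<And>g. f g \<in> carrier G"
    and "\<And>u v. (u, v) \<in> R \<Longrightarrow> word_eval G f u = word_eval G f v"
    and "pres_eq R u v"
  shows "word_eval G f u = word_eval G f v"
proof -
  interpret group G by fact
  show ?thesis using assms(4)
    by induction (auto simp: assms(2,3) word_eval_append[OF assms(1,2)])
qed

lemma gen_lift_word_class:
  assumes "group G" and "\<And>g. f g \<in> carrier G"
    and "\<And>u v. (u, v) \<in> R \<Longrightarrow> word_eval G f u = word_eval G f v"
  shows "gen_lift G f (word_class R w) = word_eval G f w"
proof -
  have "w \<in> word_class R w" by (simp add: word_class_def pres_eq.refl)
  then have "(SOME v. v \<in> word_class R w) \<in> word_class R w" by (rule someI)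
  then show ?thesis
    unfolding gen_lift_def using word_eval_cong[OF assms]
    by (metis mem_Collect_eq word_class_def)
qed

lemma gen_lift_hom:
  assumes "group G" and "\<And>g. f g \<in> carrier G"
    and "\<And>u v. (u, v) \<in> R \<Longrightarrow> word_eval G f u = word_eval G f v"
  shows "gen_lift G f \<in> hom (presented_group R) G"
    and "gen_lift G f (gen_class R g) = f g"
proof -
  interpret group G by fact
  have "carrier (presented_group R) = range (word_class R)"
    by (simp add: presented_group_def)
  then show "gen_lift G f \<in> hom (presented_group R) G"
    by (auto intro!: homI simp: gen_lift_word_class[OF assms] presented_group_mult
        word_eval_append[OF assms(1,2)] word_eval_closed[OF assms(1,2)])
  show "gen_lift G f (gen_class R g) = f g"
    by (simp add: gen_class_def gen_lift_word_class[OF assms] assms(2))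
qed


section \<open>The group of the double twist knot \<open>J(2m,-2n)\<close>\<close>

text \<open>Lin's presentation coming from a genus one free Seifert surface; \<open>Mu\<close> is a meridian. The knot
  group is identified with the group so presented.\<close>

datatype lin_gen = X1 | X2 | Mu

abbreviation letter :: "'a \<Rightarrow> 'a word" where
  "letter g \<equiv> [(g, True)]"

definition lin_relations :: "nat \<Rightarrow> nat \<Rightarrow> (lin_gen word \<times> lin_gen word) set" where
  "lin_relations m n =
    {(letter Mu @ word_pow (letter X1) m @ word_inv (letter Mu),
        word_pow (letter X1) m @ word_inv (letter X2)),
     (letter Mu @ word_pow (letter X2) n @ letter X1 @ word_inv (letter Mu),
        word_pow (letter X2) n)}"

definition knot_group :: "nat \<Rightarrow> nat \<Rightarrow> lin_gen word set monoid" where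
  "knot_group m n = presented_group (lin_relations m n)"

definition knot_gen :: "nat \<Rightarrow> nat \<Rightarrow> lin_gen \<Rightarrow> lin_gen word set" where
  "knot_gen m n = gen_class (lin_relations m n)"

definition relator1 :: "nat \<Rightarrow> lin_gen word" where
  "relator1 m = letter Mu @ word_pow (letter X1) m @ word_inv (letter Mu) @ letter X2
     @ word_inv (word_pow (letter X1) m)"

definition relator2 :: "nat \<Rightarrow> lin_gen word" where
  "relator2 n = letter Mu @ word_pow (letter X2) n @ letter X1 @ word_inv (letter Mu)
     @ word_inv (word_pow (letter X2) n)"

text \<open>The abelianization, with \<open>t\<^sup>k\<close> recorded by its exponent \<open>k\<close>.\<close>

definition alpha :: "lin_gen word set \<Rightarrow> int" where
  "alpha = gen_lift integer_group (\<lambda>g. if g = Mu then 1 else 0)"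

lemma alpha_hom:
  shows "alpha \<in> hom (knot_group m n) integer_group"
    and "alpha (knot_gen m n X1) = 0"
    and "alpha (knot_gen m n X2) = 0"
    and "alpha (knot_gen m n Mu) = 1"
proof -
  let ?f = "\<lambda>g. if g = Mu then 1 else 0 :: int"
  have carr: "?f g \<in> carrier integer_group" for g by simp
  have pow: "word_eval integer_group ?f (word_pow (letter g) k) = int k * ?f g" for g k
    by (induction k) (auto simp: word_pow_def integer_group_def)
  have rel: "word_eval integer_group ?f u = word_eval integer_group ?f v"
    if "(u, v) \<in> lin_relations m n" for u v
    using that unfolding lin_relations_def
    by (auto simp: word_eval_append[OF group_integer_group carr] pow word_inv_def)
  show "alpha \<in> hom (knot_group m n) integer_group"
    unfolding alpha_def knot_group_def
    by (rule gen_lift_hom(1)[OF group_integer_group carr rel])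
  have "alpha (knot_gen m n g) = ?f g" for g
    unfolding alpha_def knot_gen_def
    by (rule gen_lift_hom(2)[OF group_integer_group carr rel])
  then show "alpha (knot_gen m n X1) = 0" "alpha (knot_gen m n X2) = 0"
    "alpha (knot_gen m n Mu) = 1"
    by simp_all
qed


section \<open>Special linear groups and the representations \<open>\<sigma>\<^sub>n\<close>\<close>

definition SL :: "nat \<Rightarrow> complex mat monoid" where
  "SL n = \<lparr>carrier = {A \<in> carrier_mat n n. Determinant.det A = 1},
     monoid.mult = (*), one = 1\<^sub>m n\<rparr>"

definition mat2 :: "complex \<Rightarrow> complex \<Rightarrow> complex \<Rightarrow> complex \<Rightarrow> complex mat" where
  "mat2 a b c d = mat_of_rows_list 2 [[a, b], [c, d]]"

lemma group_SL: "group (SL n)"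
proof (rule groupI)
  fix A assume "A \<in> carrier (SL n)"
  then have A: "A \<in> carrier_mat n n" "Determinant.det A = 1" by (auto simp: SL_def)
  have adj: "adj_mat A \<in> carrier_mat n n" "adj_mat A * A = 1\<^sub>m n"
    using adj_mat[OF A(1)] A(2) by auto
  have "Determinant.det (adj_mat A) = 1"
    using arg_cong[OF adj(2), of Determinant.det] det_mult[OF adj(1) A(1)] A(2) by simp
  with adj show "\<exists>B\<in>carrier (SL n). B \<otimes>\<^bsub>SL n\<^esub> A = \<one>\<^bsub>SL n\<^esub>"
    by (auto simp: SL_def)
qed (auto simp: SL_def det_mult)

text \<open>Polynomials in \<open>x\<close> and \<open>y\<close> are elements of \<open>\<complex>[x][y]\<close>, so that \<open>y\<close> is the outer variable.\<close>

definition var_x :: "complex poly poly" where "var_x = [:[:0, 1:]:]"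
definition var_y :: "complex poly poly" where "var_y = [:0, 1:]"

definition const2 :: "complex \<Rightarrow> complex poly poly" where "const2 a = [:[:a:]:]"

definition subst_xy ::
  "complex poly poly \<Rightarrow> complex poly poly \<Rightarrow> complex poly poly \<Rightarrow> complex poly poly" where
  "subst_xy p X Y = poly (map_poly (\<lambda>q. poly (map_poly const2 q) X) p) Y"

definition poly_action :: "complex mat \<Rightarrow> complex poly poly \<Rightarrow> complex poly poly" where
  "poly_action A p =
    (let B = inv\<^bsub>SL 2\<^esub> A
     in subst_xy p
          (const2 (B $$ (0, 0)) * var_x + const2 (B $$ (0, 1)) * var_y)
          (const2 (B $$ (1, 0)) * var_x + const2 (B $$ (1, 1)) * var_y))"

text \<open>The matrix of the action on homogeneous polynomials of degree \<open>n - 1\<close> with respect to the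
  basis \<open>x\<^sup>n\<^sup>-\<^sup>1\<^sup>-\<^sup>j y\<^sup>j\<close>, \<open>0 \<le> j < n\<close>; column \<open>j\<close> is the image of the \<open>j\<close>-th basis vector.\<close>

definition sigma :: "nat \<Rightarrow> complex mat \<Rightarrow> complex mat" where
  "sigma n A = Matrix.mat n n (\<lambda>(k, j).
     coeff (coeff (poly_action A (var_x ^ (n - 1 - j) * var_y ^ j)) k) (n - 1 - k))"


section \<open>Fox calculus and the twisted Alexander polynomial\<close>

text \<open>The integral group ring of a group with elements of type \<open>'g\<close> has underlying additive
  group \<open>'g group_ring\<close>.\<close>

type_synonym 'g group_ring = "'g \<Rightarrow>\<^sub>0 int"

abbreviation free_group :: "'a word set monoid" where
  "free_group \<equiv> presented_group {}"

text \<open>The Fox derivative with values in the group ring of the free group, computed by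
  \<open>\<partial>(s w) = \<partial>s + s \<partial>w\<close> for a letter \<open>s\<close>, where
  \<open>\<partial>(g\<^sup>-\<^sup>1)/\<partial>g = - g\<^sup>-\<^sup>1\<close>.\<close>

primrec fox :: "'a \<Rightarrow> 'a word \<Rightarrow> 'a word set group_ring" where
  "fox x [] = 0"
| "fox x (s # w) =
     (if fst s = x
      then (if snd s then frag_of \<one>\<^bsub>free_group\<^esub> else - frag_of (word_class {} [s]))
      else 0)
     + frag_extend (\<lambda>h. frag_of (word_class {} [s] \<otimes>\<^bsub>free_group\<^esub> h)) (fox x w)"

definition to_knot_ring ::
  "nat \<Rightarrow> nat \<Rightarrow> lin_gen word set group_ring \<Rightarrow> lin_gen word set group_ring" where
  "to_knot_ring m n =
     frag_extend (\<lambda>h. frag_of (gen_lift (knot_group m n) (knot_gen m n) h))"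

text \<open>Laurent polynomials in \<open>t\<close> are viewed inside the field of rational functions.\<close>

definition var_t :: "complex poly fract" where
  "var_t = to_fract [:0, 1:]"

definition Phi :: "nat \<Rightarrow> (lin_gen word set \<Rightarrow> complex mat) \<Rightarrow>
    lin_gen word set group_ring \<Rightarrow> complex poly fract mat" where
  "Phi d \<phi> c = Matrix.mat d d (\<lambda>(a, b). \<Sum>\<gamma>\<in>Poly_Mapping.keys c.
     of_int (Poly_Mapping.lookup c \<gamma>) * var_t powi (alpha \<gamma>) * to_fract [:\<phi> \<gamma> $$ (a, b):])"

definition twisted_alexander ::
  "nat \<Rightarrow> nat \<Rightarrow> nat \<Rightarrow> (lin_gen word set \<Rightarrow> complex mat) \<Rightarrow> complex poly fract" where
  "twisted_alexander m n d \<phi> =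
    (let D = (\<lambda>r x. Phi d \<phi> (to_knot_ring m n (fox x r))) in
     Determinant.det (four_block_mat
         (D (relator1 m) X1) (D (relator1 m) X2)
         (D (relator2 n) X1) (D (relator2 n) X2))
     / Determinant.det
         (Phi d \<phi> (frag_of \<one>\<^bsub>knot_group m n\<^esub> - frag_of (knot_gen m n Mu))))"

text \<open>Evaluation uses the representation in lowest terms, so removable singularities are
  irrelevant.\<close>

definition rat_eval :: "complex poly fract \<Rightarrow> complex \<Rightarrow> complex" where
  "rat_eval r z = poly (fst (quot_of_fract r)) z / poly (snd (quot_of_fract r)) z"


section \<open>Existence of the metabelian representations\<close>

lemma mat2_carrier: "mat2 a b c d \<in> carrier_mat 2 2"
  unfolding mat2_def mat_of_rows_list_def by (rule carrier_matI) simp_all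

lemma mat2_index:
  "mat2 a b c d $$ (0, 0) = a" "mat2 a b c d $$ (0, Suc 0) = b"
  "mat2 a b c d $$ (Suc 0, 0) = c" "mat2 a b c d $$ (Suc 0, Suc 0) = d"
  by (simp_all add: mat2_def mat_of_rows_list_def)

lemma mat2_eqI:
  assumes "A \<in> carrier_mat 2 2"
    and "A $$ (0, 0) = a" "A $$ (0, Suc 0) = b" "A $$ (Suc 0, 0) = c" "A $$ (Suc 0, Suc 0) = d"
  shows "A = mat2 a b c d"
proof (rule eq_matI)
  fix k l
  assume "k < dim_row (mat2 a b c d)" "l < dim_col (mat2 a b c d)"
  then have "k = 0 \<or> k = Suc 0" "l = 0 \<or> l = Suc 0"
    using mat2_carrier[of a b c d] by auto
  then show "A $$ (k, l) = mat2 a b c d $$ (k, l)"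
    using assms(2-5) by (elim disjE) (simp_all only: mat2_index)
qed (use assms(1) mat2_carrier[of a b c d] in auto)

lemma mat2_mult:
  "mat2 a b c d * mat2 a' b' c' d' =
     mat2 (a * a' + b * c') (a * b' + b * d') (c * a' + d * c') (c * b' + d * d')"
  using mat2_carrier[of a b c d] mat2_carrier[of a' b' c' d']
  by (intro mat2_eqI) (auto simp: scalar_prod_def mat2_index numeral_2_eq_2)

lemma mat2_one: "1\<^sub>m 2 = mat2 1 0 0 1"
  by (intro mat2_eqI) auto

lemma mat2_det: "Determinant.det (mat2 a b c d) = a * d - b * c"
proof -
  have "Determinant.det (mat2 a b c d) =
      (\<Sum>j<2. mat2 a b c d $$ (0, j) * cofactor (mat2 a b c d) 0 j)"
    by (rule laplace_expansion_row[OF mat2_carrier]) simp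
  moreover have "cofactor (mat2 a b c d) 0 0 = d"
    using mat2_carrier[of a b c d]
    by (subst cofactor_def, subst det_single) (auto simp: mat_delete_def mat2_index)
  moreover have "cofactor (mat2 a b c d) 0 (Suc 0) = - c"
    using mat2_carrier[of a b c d]
    by (subst cofactor_def, subst det_single) (auto simp: mat_delete_def mat2_index)
  ultimately show ?thesis
    by (simp add: numeral_2_eq_2 mat2_index)
qed

lemma mat2_SL: "a * d - b * c = 1 \<Longrightarrow> mat2 a b c d \<in> carrier (SL 2)"
  by (simp add: SL_def mat2_carrier mat2_det)

lemma mat2_inv:
  assumes "a * d - b * c = 1"
  shows "inv\<^bsub>SL 2\<^esub> (mat2 a b c d) = mat2 d (- b) (- c) a"
proof -
  interpret group "SL 2" by (rule group_SL)
  have "mat2 d (- b) (- c) a \<otimes>\<^bsub>SL 2\<^esub> mat2 a b c d = \<one>\<^bsub>SL 2\<^esub>"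
  proof -
    have "d * a + (- b) * c = 1" "d * b + (- b) * d = 0" "(- c) * a + a * c = 0"
      "(- c) * b + a * d = 1"
      using assms by (simp_all add: mult.commute)
    then show ?thesis
      by (simp only: SL_def monoid.simps partial_object.simps mat2_mult mat2_one)
  qed
  moreover have "d * a - (- b) * (- c) = 1"
    using assms by (simp add: mult.commute)
  ultimately show ?thesis
    using assms by (blast intro: inv_equality mat2_SL)
qed

lemma metabelian_rep_exists:
  fixes m n :: nat and a :: complex
  assumes "a ^ (4 * m * n + 1) = 1"
  shows "\<exists>\<rho> \<in> hom (knot_group m n) (SL 2).
     \<rho> (knot_gen m n X1) = mat2 a 0 0 (inverse a) \<and>
     \<rho> (knot_gen m n X2) = mat2 (a ^ (2 * m)) 0 0 (inverse (a ^ (2 * m))) \<and>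
     \<rho> (knot_gen m n Mu) = mat2 0 1 (- 1) 0"
proof -
  have a: "a \<noteq> 0" using assms by (auto simp: power_0_left)
  define f where "f g = (case g of X1 \<Rightarrow> mat2 a 0 0 (inverse a)
     | X2 \<Rightarrow> mat2 (a ^ (2 * m)) 0 0 (inverse (a ^ (2 * m)))
     | Mu \<Rightarrow> mat2 0 1 (- 1) 0)" for g
  have carr: "f g \<in> carrier (SL 2)" for g
    by (cases g) (auto simp: f_def a intro!: mat2_SL)
  have one: "\<one>\<^bsub>SL 2\<^esub> = mat2 1 0 0 1"
    by (simp add: SL_def mat2_one)
  have mult: "A \<otimes>\<^bsub>SL 2\<^esub> B = A * B" for A B by (simp add: SL_def)
  have pow1: "word_eval (SL 2) f (word_pow (letter X1) k) = mat2 (a ^ k) 0 0 (inverse (a ^ k))" for k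
    by (induction k) (auto simp: word_pow_def one mult f_def mat2_mult)
  have pow2: "word_eval (SL 2) f (word_pow (letter X2) k) =
      mat2 (a ^ (2 * m * k)) 0 0 (inverse (a ^ (2 * m * k)))" for k
    by (induction k) (auto simp: word_pow_def one mult f_def mat2_mult power_add)
  have let1: "word_eval (SL 2) f (letter g) = f g" for g
  proof -
    interpret group "SL 2" by (rule group_SL)
    show ?thesis using carr[of g] by simp
  qed
  have let2: "word_eval (SL 2) f (word_inv (letter g)) = inv\<^bsub>SL 2\<^esub> f g" for g
  proof -
    interpret group "SL 2" by (rule group_SL)
    show ?thesis using carr[of g] by (simp add: word_inv_def)
  qed
  have invMu: "inv\<^bsub>SL 2\<^esub> f Mu = mat2 0 (- 1) 1 0"
    by (simp add: f_def mat2_inv)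
  have invX2: "inv\<^bsub>SL 2\<^esub> f X2 = mat2 (inverse (a ^ (2 * m))) 0 0 (a ^ (2 * m))"
    using a by (simp add: f_def mat2_inv)
  have key: "a ^ (2 * m * n) * (a ^ (2 * m * n) * a) = 1"
  proof -
    have "4 * m * n + 1 = 2 * m * n + (2 * m * n + 1)" by simp
    then show ?thesis using assms by (simp only: power_add power_one_right)
  qed
  have rel: "word_eval (SL 2) f u = word_eval (SL 2) f v"
    if uv: "(u, v) \<in> lin_relations m n" for u v
  proof -
    note ev = word_eval_append[OF group_SL carr] pow1 pow2 let1 let2 invMu invX2 mult
    have E: "a ^ (2 * m * n) * a = inverse (a ^ (2 * m * n))"
      using key a by (metis inverse_unique)
    consider
      "u = letter Mu @ word_pow (letter X1) m @ word_inv (letter Mu)"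
      "v = word_pow (letter X1) m @ word_inv (letter X2)"
    | "u = letter Mu @ word_pow (letter X2) n @ letter X1 @ word_inv (letter Mu)"
      "v = word_pow (letter X2) n"
      using uv unfolding lin_relations_def by blast
    then show ?thesis
    proof cases
      case 1
      have "x * (inverse x * inverse x) = inverse x" "inverse x * (x * x) = x"
        if "x \<noteq> 0" for x :: complex
        using that by simp_all
      then have c: "a ^ m * (inverse (a ^ m) * inverse (a ^ m)) = inverse (a ^ m)"
        "inverse (a ^ m) * (a ^ m * a ^ m) = a ^ m"
        using a by simp_all
      show ?thesis unfolding 1 ev
        by (simp add: f_def invX2[unfolded f_def] mat2_mult mult_2 power_add c)
    next
      case 2
      have E': "inverse (a ^ (2 * m * n)) * inverse a = a ^ (2 * m * n)"
        using arg_cong[OF E, of inverse] by (simp add: mult.commute)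
      show ?thesis unfolding 2 ev
        by (simp add: f_def mat2_mult E E')
    qed
  qed
  show ?thesis
  proof (intro bexI conjI)
    show "gen_lift (SL 2) f \<in> hom (knot_group m n) (SL 2)"
      unfolding knot_group_def by (rule gen_lift_hom(1)[OF group_SL carr rel])
    have "gen_lift (SL 2) f (knot_gen m n g) = f g" for g
      unfolding knot_gen_def by (rule gen_lift_hom(2)[OF group_SL carr rel])
    then show "gen_lift (SL 2) f (knot_gen m n X1) = mat2 a 0 0 (inverse a)"
      "gen_lift (SL 2) f (knot_gen m n X2) = mat2 (a ^ (2 * m)) 0 0 (inverse (a ^ (2 * m)))"
      "gen_lift (SL 2) f (knot_gen m n Mu) = mat2 0 1 (- 1) 0"
      by (simp_all add: f_def)
  qed
qed

end

theory Submission
  imports Defs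
begin

text \<open>Under \<open>\<sigma>\<^sub>2\<^sub>N\<close> the images of \<open>x\<^sub>1\<close> and \<open>x\<^sub>2\<close> are diagonal and that of \<open>\<mu>\<close> is antidiagonal, so
  the representation splits into \<open>N\<close> planes on which \<open>x\<^sub>1\<close> has the eigenvalues \<open>z\<close> and \<open>z\<^sup>-\<^sup>1\<close> with
  \<open>z = \<xi>\<^bsup>i(2k+1)\<^esup>\<close>, \<open>0 \<le> k < N\<close>. On each plane the twisted Alexander polynomial is
  \<open>(w (1 + t\<^sup>4) + v t\<^sup>2) / (1 + t\<^sup>2)\<close> for constants \<open>w\<close> and \<open>v\<close> depending on \<open>z\<close>. If \<open>z = 1\<close>, the numerator is the one in
  the limit; if \<open>z \<noteq> 1\<close>, then \<open>v = 2 w\<close> and \<open>w = |1 + x|\<^sup>-\<^sup>2 |1 + x\<^sup>2\<^sup>m|\<^sup>-\<^sup>2\<close> with \<open>x\<^sup>2 = z\<close>. The sequence of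
  factors has period \<open>q\<close>, the value \<open>z = 1\<close> occurs once per period, and the other \<open>w\<close> multiply
  to \<open>1\<close>, because the product of \<open>1 + u\<close> over the nontrivial \<open>q\<close>-th roots of unity is \<open>1\<close> for odd \<open>q\<close>.
  The limit is the average of the logarithms over one period.\<close>

section \<open>Matrices supported on the two diagonals\<close>

text \<open>Both diagonals are indexed by the column. Where they cross, in the centre of an odd
  size, the entries are added, so that the product formula needs no case distinction.\<close>

definition xmat :: "nat \<Rightarrow> (nat \<Rightarrow> 'a::comm_ring_1) \<Rightarrow> (nat \<Rightarrow> 'a) \<Rightarrow> 'a mat" where
  "xmat d f g = Matrix.mat d d
     (\<lambda>(k, j). (if k = j then f j else 0) + (if k = d - 1 - j then g j else 0))"

lemma xmat_carrier [simp]: "xmat d f g \<in> carrier_mat d d"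
  by (simp add: xmat_def)

lemma xmat_cong:
  assumes "\<And>j. j < d \<Longrightarrow> f j = f' j" and "\<And>j. j < d \<Longrightarrow> g j = g' j"
  shows "xmat d f g = xmat d f' g'"
  using assms by (auto simp: xmat_def intro!: eq_matI)

text \<open>Column \<open>j\<close> of the right factor is supported in the rows \<open>j\<close>
  and \<open>d - 1 - j\<close>, so only these two columns of the left factor contribute; the second
  one is read at the reversed index.\<close>

lemma xmat_mult:
  "xmat d f g * xmat d f' g' =
     xmat d (\<lambda>j. f j * f' j + g (d - 1 - j) * g' j) (\<lambda>j. g j * f' j + f (d - 1 - j) * g' j)"
proof (rule eq_matI)
  fix k j assume kj: "k < dim_row (xmat d (\<lambda>j. f j * f' j + g (d - 1 - j) * g' j)
      (\<lambda>j. g j * f' j + f (d - 1 - j) * g' j))"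
    "j < dim_col (xmat d (\<lambda>j. f j * f' j + g (d - 1 - j) * g' j)
      (\<lambda>j. g j * f' j + f (d - 1 - j) * g' j))"
  then have k: "k < d" and j: "j < d" by (simp_all add: xmat_def)
  let ?h = "\<lambda>l. (if k = l then f l else 0) + (if k = d - 1 - l then g l else 0)"
  have "(xmat d f g * xmat d f' g') $$ (k, j) =
    (\<Sum>l = 0..<d. ?h l * ((if l = j then f' j else 0) + (if l = d - 1 - j then g' j else 0)))"
    using k j by (simp add: xmat_def scalar_prod_def)
  also have "\<dots> = (\<Sum>l = 0..<d. (if l = j then ?h l * f' j else 0))
      + (\<Sum>l = 0..<d. (if l = d - 1 - j then ?h l * g' j else 0))"
    unfolding sum.distrib [symmetric]
    by (rule sum.cong) (simp_all only: distrib_left mult_zero_right if_distrib [of "(*) _"])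
  also have "\<dots> = ?h j * f' j + ?h (d - 1 - j) * g' j"
    using j by (subst (1 2) sum.delta) auto
  finally show "(xmat d f g * xmat d f' g') $$ (k, j) = xmat d (\<lambda>j. f j * f' j + g (d - 1 - j) * g' j)
      (\<lambda>j. g j * f' j + f (d - 1 - j) * g' j) $$ (k, j)"
    using k j by (auto simp: xmat_def algebra_simps)
qed (simp_all add: xmat_def)

lemma xmat_add: "xmat d f g + xmat d f' g' = xmat d (\<lambda>j. f j + f' j) (\<lambda>j. g j + g' j)"
  by (auto simp: xmat_def intro!: eq_matI)

lemma xmat_minus: "xmat d f g - xmat d f' g' = xmat d (\<lambda>j. f j - f' j) (\<lambda>j. g j - g' j)"
  by (auto simp: xmat_def intro!: eq_matI)

lemma xmat_uminus: "- xmat d f g = xmat d (\<lambda>j. - f j) (\<lambda>j. - g j)"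
  by (auto simp: xmat_def intro!: eq_matI)

lemma xmat_one: "1\<^sub>m d = xmat d (\<lambda>_. 1) (\<lambda>_. 0)"
  by (auto simp: xmat_def intro!: eq_matI)

lemma xmat_zero: "0\<^sub>m d d = xmat d (\<lambda>_. 0) (\<lambda>_. 0)"
  by (auto simp: xmat_def intro!: eq_matI)

lemma det_xmat_diagonal: "Determinant.det (xmat d f (\<lambda>_. 0)) = (\<Prod>j<d. f j)"
proof -
  have "Determinant.det (xmat d f (\<lambda>_. 0)) = prod_list (diag_mat (xmat d f (\<lambda>_. 0)))"
    by (rule det_lower_triangular[where n = d]) (auto simp: xmat_def)
  also have "\<dots> = (\<Prod>j<d. f j)"
    unfolding prod_list_diag_prod by (auto simp: xmat_def lessThan_atLeast0 intro!: prod.cong)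
  finally show ?thesis .
qed

text \<open>The index reversal is an involution without fixed points, so that the matrix is similar to a
  direct sum of \<open>N\<close> matrices of size \<open>2\<close>. In the proof the second half of the basis is put in
  reverse order, which makes all four blocks diagonal.\<close>

lemma det_xmat:
  fixes f g :: "nat \<Rightarrow> 'a::idom"
  shows "Determinant.det (xmat (2 * N) f g) =
    (\<Prod>j<N. f j * f (2 * N - 1 - j) - g j * g (2 * N - 1 - j))"
proof -
  let ?r = "\<lambda>j. 2 * N - 1 - j"
  let ?D = "\<lambda>h. xmat N h (\<lambda>_. 0)"
  let ?J = "xmat N (\<lambda>_. 0) (\<lambda>_. 1) :: 'a mat"
  let ?P = "four_block_mat (1\<^sub>m N) (0\<^sub>m N N) (0\<^sub>m N N) ?J"
  let ?Q = "four_block_mat (?D f) (?D (\<lambda>j. g (?r j))) (?D g) (?D (\<lambda>j. f (?r j)))"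
  have P: "?P \<in> carrier_mat (2 * N) (2 * N)" and Q: "?Q \<in> carrier_mat (2 * N) (2 * N)"
    by (auto simp: mult_2)
  have JJ: "?J * ?J = 1\<^sub>m N"
    unfolding xmat_mult xmat_one by (rule xmat_cong) auto
  have X: "xmat (2 * N) f g = ?P * ?Q * ?P"
  proof -
    have PQ: "?P * ?Q = four_block_mat (?D f) (?D (\<lambda>j. g (?r j)))
        (?J * ?D g) (?J * ?D (\<lambda>j. f (?r j)))"
      by (subst mult_four_block_mat[where ?n1.0 = N and ?n2.0 = N and ?nr1.0 = N and ?nr2.0 = N and ?nc1.0 = N and ?nc2.0 = N])
        (simp_all add: xmat_one xmat_zero xmat_mult xmat_add)
    have "?P * ?Q * ?P = four_block_mat (?D f) (?D (\<lambda>j. g (?r j)) * ?J)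
        (?J * ?D g) (?J * ?D (\<lambda>j. f (?r j)) * ?J)"
      unfolding PQ by (subst mult_four_block_mat[where ?n1.0 = N and ?n2.0 = N and ?nr1.0 = N and ?nr2.0 = N and ?nc1.0 = N and ?nc2.0 = N])
        (simp_all add: xmat_one xmat_zero xmat_mult xmat_add)
    also have "\<dots> = xmat (2 * N) f g" (is "?L = ?R")
    proof (rule eq_matI)
      fix k j assume "k < dim_row ?R" "j < dim_col ?R"
      then have kj: "k < 2 * N" "j < 2 * N" by (simp_all add: xmat_def)
      have idx: "2 * N - 1 - (N - 1 - (j - N)) = j" "N - 1 - (j - N) = 2 * N - 1 - j" if "N \<le> j"
        using that kj by auto
      consider "k < N" "j < N" | "k < N" "N \<le> j" | "N \<le> k" "j < N" | "N \<le> k" "N \<le> j"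
        by linarith
      then show "?L $$ (k, j) = ?R $$ (k, j)"
      proof cases
        case 1
        then have "k \<noteq> 2 * N - 1 - j" by linarith
        with 1 kj show ?thesis by (simp add: xmat_mult) (simp add: xmat_def)
      next
        case 2
        with kj idx show ?thesis by (simp add: xmat_mult) (simp add: xmat_def)
      next
        case 3
        then have "k - N = N - 1 - j \<longleftrightarrow> k = 2 * N - 1 - j" using kj by linarith
        with 3 kj show ?thesis by (simp add: xmat_mult) (simp add: xmat_def)
      next
        case 4
        then have "k \<noteq> 2 * N - 1 - j" "k - N = j - N \<longleftrightarrow> k = j" using kj by linarith+
        with 4 kj idx show ?thesis by (simp add: xmat_mult) (simp add: xmat_def)
      qed
    qed (simp_all add: xmat_def)
    finally show ?thesis ..
  qed
  have "Determinant.det ?P = Determinant.det ?J"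
    by (subst det_four_block_mat_upper_right_zero[OF _ HOL.refl]) auto
  \<comment> \<open>The sign of the reversing permutation is never computed, because
    \<open>?P\<close> enters twice.\<close>
  then have PP: "Determinant.det ?P * Determinant.det ?P = 1"
    using det_mult[of ?J N ?J] JJ by simp
  have "Determinant.det (xmat (2 * N) f g) =
      Determinant.det ?Q * (Determinant.det ?P * Determinant.det ?P)"
    using P Q by (simp add: X det_mult[where n = "2 * N"])
  also have "\<dots> = Determinant.det ?Q"
    using PP by simp
  \<comment> \<open>The four blocks are diagonal and commute, which permits the 2 by 2 formula for
    the block determinant.\<close>
  also have "\<dots> = Determinant.det (?D f * ?D (\<lambda>j. f (?r j)) - ?D (\<lambda>j. g (?r j)) * ?D g)"
    by (rule det_four_block_mat[of _ N]) (simp_all add: xmat_mult mult.commute)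
  also have "\<dots> = (\<Prod>j<N. f j * f (?r j) - g j * g (?r j))"
    by (simp add: xmat_mult xmat_minus det_xmat_diagonal mult.commute)
  finally show ?thesis .
qed

text \<open>Column operations of determinant 1: \<open>?S\<close> exchanges the two block columns
  and negates one, and \<open>?U\<close> then clears the upper right block. The pivot is
  \<open>B\<close> because in the Fox matrix this block, the derivative of the first relator by
  \<open>X2\<close>, is an invertible diagonal matrix.\<close>

lemma det_four_block_mat_schur:
  fixes A B B' C D :: "'a::idom mat"
  assumes A: "A \<in> carrier_mat k k" and B: "B \<in> carrier_mat k k" and B': "B' \<in> carrier_mat k k"
    and C: "C \<in> carrier_mat k k" and D: "D \<in> carrier_mat k k" and BB': "B * B' = 1\<^sub>m k"
  shows "Determinant.det (four_block_mat A B C D) =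
    Determinant.det (- B) * Determinant.det (C - D * (B' * A))"
proof -
  let ?S = "four_block_mat (0\<^sub>m k k) (1\<^sub>m k) (- 1\<^sub>m k) (0\<^sub>m k k) :: 'a mat"
  let ?U = "four_block_mat (1\<^sub>m k) (B' * A) (0\<^sub>m k k) (1\<^sub>m k)"
  let ?M = "four_block_mat A B C D"
  have carr: "?M \<in> carrier_mat (k + k) (k + k)" "?S \<in> carrier_mat (k + k) (k + k)"
    "?U \<in> carrier_mat (k + k) (k + k)"
    using A D by auto
  have "0\<^sub>m k k * 0\<^sub>m k k - 1\<^sub>m k * (- 1\<^sub>m k) = (1\<^sub>m k :: 'a mat)"
    by (auto intro!: eq_matI)
  then have detS: "Determinant.det ?S = 1"
    by (subst det_four_block_mat) auto
  have detU: "Determinant.det ?U = 1"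
    using A B' by (subst det_four_block_mat_lower_left_zero[where n = k and m = k]) auto
  have BBA: "B * (B' * A) = A"
    using assoc_mult_mat[OF B B' A] BB' A by simp
  have MS: "?M * ?S = four_block_mat (- B) A (- D) C"
    using A B C D by (subst mult_four_block_mat) auto
  have MSU: "?M * ?S * ?U = four_block_mat (- B) (0\<^sub>m k k) (- D) (C - D * (B' * A))"
    unfolding MS
  proof (subst mult_four_block_mat[where ?n1.0 = k and ?n2.0 = k and ?nr1.0 = k and ?nr2.0 = k and ?nc1.0 = k and ?nc2.0 = k])
    have "- B * (B' * A) + A * 1\<^sub>m k = 0\<^sub>m k k"
      using A B B' BBA by (auto simp: uminus_mult_left_mat intro!: eq_matI)
    moreover have "- D * (B' * A) + C * 1\<^sub>m k = C - D * (B' * A)"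
      using A B' C D by (auto intro!: eq_matI)
    moreover have "- B * 1\<^sub>m k + A * 0\<^sub>m k k = - B" "- D * 1\<^sub>m k + C * 0\<^sub>m k k = - D"
      using A B C D by auto
    ultimately show "four_block_mat (- B * 1\<^sub>m k + A * 0\<^sub>m k k) (- B * (B' * A) + A * 1\<^sub>m k)
        (- D * 1\<^sub>m k + C * 0\<^sub>m k k) (- D * (B' * A) + C * 1\<^sub>m k) =
      four_block_mat (- B) (0\<^sub>m k k) (- D) (C - D * (B' * A))" by simp
  qed (use A B B' C D in auto)
  have "Determinant.det (?M * ?S * ?U) =
      Determinant.det (- B) * Determinant.det (C - D * (B' * A))"
    unfolding MSU
    using A B B' C D by (intro det_four_block_mat_upper_right_zero[OF _ HOL.refl]) auto
  moreover have "Determinant.det (?M * ?S * ?U) = Determinant.det ?M"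
    using carr detS detU by (simp add: det_mult[where n = "k + k"])
  ultimately show ?thesis by simp
qed

section \<open>The representation \<open>\<sigma>\<^sub>d\<close> on monomial matrices\<close>

lemma monomial_eq: "const2 c * var_x ^ p * var_y ^ q = Polynomial.monom (Polynomial.monom c p) q"
proof -
  have "[:Q:] ^ p = [:Q ^ p:]" for Q :: "complex poly"
    by (induction p) simp_all
  then show ?thesis
    by (simp add: const2_def var_x_def var_y_def monom_altdef)
qed

lemma const2_simps [simp]:
  "const2 0 = 0" "const2 1 = 1" "const2 (a * b) = const2 a * const2 b"
  by (simp_all add: const2_def one_pCons)

lemma const2_power [simp]: "const2 (a ^ k) = const2 a ^ k"
  by (induction k) simp_all

lemma subst_xy_monomial: "subst_xy (var_x ^ p * var_y ^ q) X Y = X ^ p * Y ^ q"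
  using monomial_eq[of 1 p q]
  by (simp add: subst_xy_def map_poly_monom poly_monom)

lemma poly_action_diag:
  assumes "b \<noteq> 0"
  shows "poly_action (mat2 b 0 0 (inverse b)) (var_x ^ p * var_y ^ q) =
    Polynomial.monom (Polynomial.monom (inverse b ^ p * b ^ q) p) q"
proof -
  have inv: "inv\<^bsub>SL 2\<^esub> (mat2 b 0 0 (inverse b)) = mat2 (inverse b) 0 0 b"
    using assms by (simp add: mat2_inv)
  show ?thesis
    unfolding poly_action_def Let_def inv subst_xy_monomial monomial_eq [symmetric]
    by (simp add: mat2_index power_mult_distrib mult_ac)
qed

lemma poly_action_antidiag:
  assumes "b \<noteq> 0"
  shows "poly_action (mat2 0 b (- inverse b) 0) (var_x ^ p * var_y ^ q) =
    Polynomial.monom (Polynomial.monom ((- b) ^ p * inverse b ^ q) q) p"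
proof -
  have inv: "inv\<^bsub>SL 2\<^esub> (mat2 0 b (- inverse b) 0) = mat2 0 (- b) (inverse b) 0"
    using assms by (simp add: mat2_inv)
  show ?thesis
    unfolding poly_action_def Let_def inv subst_xy_monomial monomial_eq [symmetric]
    by (simp add: mat2_index power_mult_distrib mult_ac)
qed

lemma powi_nat_diff:
  fixes b :: "'a::field"
  assumes "b \<noteq> 0"
  shows "b powi (int p - int q) = b ^ p * inverse b ^ q"
  using assms by (simp add: power_int_diff power_inverse divide_inverse)

text \<open>The action substitutes by the inverse matrix: x is scaled by the inverse of
  \<open>b\<close> and y by \<open>b\<close>. The basis vector with exponents
  \<open>d - 1 - j\<close> and \<open>j\<close> thus has weight
  \<open>j - (d - 1 - j)\<close>.\<close>

lemma sigma_diag: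
  assumes "b \<noteq> 0"
  shows "sigma d (mat2 b 0 0 (inverse b)) =
    xmat d (\<lambda>j. b powi (2 * int j - int (d - 1))) (\<lambda>_. 0)"
proof (rule eq_matI)
  fix k j assume "k < dim_row (xmat d (\<lambda>j. b powi (2 * int j - int (d - 1))) (\<lambda>_. 0))"
    "j < dim_col (xmat d (\<lambda>j. b powi (2 * int j - int (d - 1))) (\<lambda>_. 0))"
  then have "k < d" "j < d" by (simp_all add: xmat_def)
  moreover have "b powi (2 * int j - int (d - 1)) = inverse b ^ (d - 1 - j) * b ^ j"
  proof -
    have "2 * int j - int (d - 1) = int j - int (d - 1 - j)"
      using \<open>j < d\<close> by linarith
    then show ?thesis
      using powi_nat_diff[OF assms] by (simp only: mult.commute)
  qed
  ultimately show "sigma d (mat2 b 0 0 (inverse b)) $$ (k, j) =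
      xmat d (\<lambda>j. b powi (2 * int j - int (d - 1))) (\<lambda>_. 0) $$ (k, j)"
    using assms by (simp add: sigma_def poly_action_diag xmat_def)
qed (simp_all add: sigma_def xmat_def)

text \<open>The inverse matrix sends x to \<open>- b\<close> times y and y to
  \<open>inverse b\<close> times x. The exponents are exchanged, so column \<open>j\<close> lands in
  row \<open>d - 1 - j\<close>, and the sign is raised to the exponent of x.\<close>

lemma sigma_antidiag:
  assumes "b \<noteq> 0"
  shows "sigma d (mat2 0 b (- inverse b) 0) =
    xmat d (\<lambda>_. 0) (\<lambda>j. (- 1) ^ (d - 1 - j) * b powi (int (d - 1) - 2 * int j))"
proof (rule eq_matI)
  fix k j assume "k < dim_row (xmat d (\<lambda>_. 0) (\<lambda>j. (- 1) ^ (d - 1 - j) * b powi (int (d - 1) - 2 * int j)))"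
    "j < dim_col (xmat d (\<lambda>_. 0) (\<lambda>j. (- 1) ^ (d - 1 - j) * b powi (int (d - 1) - 2 * int j)))"
  then have kj: "k < d" "j < d" by (simp_all add: xmat_def)
  then have "d - 1 - k = j \<longleftrightarrow> k = d - 1 - j" "d - 1 - j = k \<longleftrightarrow> k = d - 1 - j" by linarith+
  moreover have "b powi (int (d - 1) - 2 * int j) = b ^ (d - 1 - j) * inverse b ^ j"
  proof -
    have "int (d - 1) - 2 * int j = int (d - 1 - j) - int j"
      using \<open>j < d\<close> by linarith
    then show ?thesis
      using powi_nat_diff[OF assms] by (simp only: mult.commute)
  qed
  moreover have "(- b) ^ (d - 1 - j) = (- 1) ^ (d - 1 - j) * b ^ (d - 1 - j)"
    by (rule power_minus)
  ultimately show "sigma d (mat2 0 b (- inverse b) 0) $$ (k, j) =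
      xmat d (\<lambda>_. 0) (\<lambda>j. (- 1) ^ (d - 1 - j) * b powi (int (d - 1) - 2 * int j)) $$ (k, j)"
    using assms kj by (simp add: sigma_def poly_action_antidiag xmat_def)
qed (simp_all add: sigma_def xmat_def)

text \<open>The normalizer of the diagonal torus. It contains the image of \<rho>, and on it the
  multiplicativity of \<open>sigma\<close> can be read off from the explicit two-diagonal
  matrices.\<close>

definition monomial_SL2 :: "complex mat set" where
  "monomial_SL2 = {A. \<exists>b. b \<noteq> 0 \<and> (A = mat2 b 0 0 (inverse b) \<or> A = mat2 0 b (- inverse b) 0)}"

lemma monomial_SL2_cases [consumes 1, case_names diag antidiag]:
  assumes "A \<in> monomial_SL2"
  obtains b where "b \<noteq> 0" "A = mat2 b 0 0 (inverse b)"
    | b where "b \<noteq> 0" "A = mat2 0 b (- inverse b) 0"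
  using assms unfolding monomial_SL2_def by blast

lemma monomial_SL2_diag: "b \<noteq> 0 \<Longrightarrow> mat2 b 0 0 (inverse b) \<in> monomial_SL2"
  and monomial_SL2_antidiag: "b \<noteq> 0 \<Longrightarrow> mat2 0 b (- inverse b) 0 \<in> monomial_SL2"
  unfolding monomial_SL2_def by blast+

lemma monomial_SL2_mult:
  "mat2 b 0 0 (inverse b) * mat2 c 0 0 (inverse c) = mat2 (b * c) 0 0 (inverse (b * c))"
  "mat2 b 0 0 (inverse b) * mat2 0 c (- inverse c) 0 = mat2 0 (b * c) (- inverse (b * c)) 0"
  "mat2 0 b (- inverse b) 0 * mat2 c 0 0 (inverse c) = mat2 0 (b * inverse c) (- inverse (b * inverse c)) 0"
  "mat2 0 b (- inverse b) 0 * mat2 0 c (- inverse c) 0 =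
     mat2 (- (b * inverse c)) 0 0 (inverse (- (b * inverse c)))"
  by (simp_all add: mat2_mult)

lemma monomial_SL2_closed:
  assumes "A \<in> monomial_SL2" "B \<in> monomial_SL2"
  shows "A * B \<in> monomial_SL2"
  using assms
  by (elim monomial_SL2_cases)
    (simp_all add: monomial_SL2_mult monomial_SL2_diag monomial_SL2_antidiag
      del: inverse_mult_distrib inverse_minus_eq)

lemma monomial_SL2_inv:
  assumes "A \<in> monomial_SL2"
  shows "inv\<^bsub>SL 2\<^esub> A \<in> monomial_SL2"
  using assms
proof (cases rule: monomial_SL2_cases)
  case (diag b)
  then show ?thesis
    using monomial_SL2_diag[of "inverse b"] by (simp add: mat2_inv)
next
  case (antidiag b)
  then show ?thesis
    using monomial_SL2_antidiag[of "- b"] by (simp add: mat2_inv)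
qed

lemma neg_one_powi_nat_diff: "(- 1 :: 'a::field) powi (int a - int b) = (- 1) ^ (a + b)"
  by (cases "even b") (simp_all add: power_int_diff power_add)

lemma sigma_mult:
  assumes "A \<in> monomial_SL2" "B \<in> monomial_SL2"
  shows "sigma d (A * B) = sigma d A * sigma d B"
proof -
  have rev: "int (d - 1 - j) = int (d - 1) - int j" "d - 1 - (d - 1 - j) = j" if "j < d" for j
    using that by auto
  have nz: "b * c \<noteq> 0" "b * inverse c \<noteq> 0" "- (b * inverse c) \<noteq> 0" if "b \<noteq> 0" "c \<noteq> 0" for b c :: complex
    using that by auto
  from assms(1) show ?thesis
  proof (cases rule: monomial_SL2_cases)
    case b: (diag b)
    from assms(2) show ?thesis
    proof (cases rule: monomial_SL2_cases)
      case c: (diag c)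
      show ?thesis unfolding b(2) c(2) monomial_SL2_mult sigma_diag[OF nz(1)[OF b(1) c(1)]]
          sigma_diag[OF b(1)] sigma_diag[OF c(1)] xmat_mult
        by (rule xmat_cong) (simp_all add: power_int_mult_distrib)
    next
      case c: (antidiag c)
      show ?thesis unfolding b(2) c(2) monomial_SL2_mult sigma_antidiag[OF nz(1)[OF b(1) c(1)]]
          sigma_diag[OF b(1)] sigma_antidiag[OF c(1)] xmat_mult
        by (rule xmat_cong) (simp_all add: power_int_mult_distrib rev algebra_simps)
    qed
  next
    case b: (antidiag b)
    from assms(2) show ?thesis
    proof (cases rule: monomial_SL2_cases)
      case c: (diag c)
      have "inverse c powi k = c powi (- k)" for k
        by (simp add: power_int_minus power_int_inverse)
      then show ?thesis unfolding b(2) c(2) monomial_SL2_mult sigma_antidiag[OF nz(2)[OF b(1) c(1)]]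
          sigma_antidiag[OF b(1)] sigma_diag[OF c(1)] xmat_mult
        by (intro xmat_cong) (simp_all add: power_int_mult_distrib rev algebra_simps)
    next
      case c: (antidiag c)
      have inv: "inverse c powi k = c powi (- k)" for k
        by (simp add: power_int_minus power_int_inverse)
      \<comment> \<open>Modulo 2 the exponent is \<open>d - 1\<close>, and
        \<open>(d - 1 - j) + j = d - 1\<close> splits the sign into those of the two antidiagonal
        factors.\<close>
      have sgn: "(- (b * inverse c)) powi (2 * int j - int (d - 1)) =
          (- 1) ^ (d - 1 - (d - 1 - j)) * (- 1) ^ (d - 1 - j) *
          (b powi (2 * int j - int (d - 1)) * c powi (int (d - 1) - 2 * int j))" if "j < d" for j
      proof -
        have "(- (b * inverse c)) powi (2 * int j - int (d - 1)) =
          (- 1) powi (int (2 * j) - int (d - 1)) *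
          (b powi (2 * int j - int (d - 1)) * c powi (int (d - 1) - 2 * int j))"
          using power_int_mult_distrib[of "- 1" "b * inverse c" "2 * int j - int (d - 1)"]
            power_int_mult_distrib[of b "inverse c" "2 * int j - int (d - 1)"]
          by (simp add: inv)
        also have "(- 1 :: complex) powi (int (2 * j) - int (d - 1)) = (- 1) ^ (d - 1)"
          unfolding neg_one_powi_nat_diff by (simp add: power_add power_mult)
        also have "\<dots> = (- 1) ^ (d - 1 - (d - 1 - j)) * (- 1) ^ (d - 1 - j)"
          using that by (simp flip: power_add)
        finally show ?thesis .
      qed
      show ?thesis unfolding b(2) c(2) monomial_SL2_mult sigma_diag[OF nz(3)[OF b(1) c(1)]]
          sigma_antidiag[OF b(1)] sigma_antidiag[OF c(1)] xmat_mult
        by (rule xmat_cong) (simp_all only: sgn, simp_all add: rev algebra_simps)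
    qed
  qed
qed

section \<open>Fox derivatives under the representation\<close>

definition cst :: "complex \<Rightarrow> complex poly fract" where
  "cst z = to_fract [:z:]"

lemma cst_simps [simp]:
  "cst 0 = 0" "cst 1 = 1" "cst (a + b) = cst a + cst b" "cst (a * b) = cst a * cst b"
  "cst (- a) = - cst a" "cst (a - b) = cst a - cst b" "cst a = 0 \<longleftrightarrow> a = 0"
  by (simp_all add: cst_def flip: to_fract_add to_fract_mult to_fract_uminus to_fract_diff one_pCons)

lemma cst_power [simp]: "cst (a ^ k) = cst a ^ k"
  by (induction k) simp_all

lemma cst_inverse [simp]: "cst (inverse a) = inverse (cst a)"
proof (cases "a = 0")
  case False
  then have "cst a * cst (inverse a) = 1"
    by (simp flip: cst_simps(4))
  then show ?thesis by (rule inverse_unique [symmetric])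
qed simp

lemma cst_powi [simp]: "cst (a powi k) = cst a powi k"
  by (simp add: power_int_def)

lemma cst_sum [simp]: "cst (sum f A) = (\<Sum>x\<in>A. cst (f x))"
  by (induction A rule: infinite_finite_induct) simp_all

lemma var_t_nonzero [simp]: "var_t \<noteq> 0"
  by (simp add: var_t_def)

section \<open>Linearity of \<open>Phi\<close> on the group ring and supports of Fox
  derivatives\<close>

lemma frag_sum_superset:
  assumes "finite S" "Poly_Mapping.keys c \<subseteq> S"
  shows "(\<Sum>\<gamma>\<in>Poly_Mapping.keys c. of_int (Poly_Mapping.lookup c \<gamma>) * h \<gamma>) =
    (\<Sum>\<gamma>\<in>S. of_int (Poly_Mapping.lookup c \<gamma>) * (h \<gamma> :: 'b::ring_1))"
  using assms by (intro sum.mono_neutral_left) (auto simp: in_keys_iff)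

lemma Phi_carrier [simp]: "Phi d \<phi> c \<in> carrier_mat d d"
  by (simp add: Phi_def)

lemma Phi_diff: "Phi d \<phi> (a - b) = Phi d \<phi> a - Phi d \<phi> b"
proof (rule eq_matI)
  fix k j assume "k < dim_row (Phi d \<phi> a - Phi d \<phi> b)" "j < dim_col (Phi d \<phi> a - Phi d \<phi> b)"
  then have kj: "k < d" "j < d" by (simp_all add: Phi_def)
  \<comment> \<open>Cancellation can shrink the support of the difference, so all three sums are
    taken over the union of the supports.\<close>
  let ?S = "Poly_Mapping.keys a \<union> Poly_Mapping.keys b"
  let ?h = "\<lambda>\<gamma>. var_t powi (alpha \<gamma>) * to_fract [:\<phi> \<gamma> $$ (k, j):]"
  have eq: "Phi d \<phi> c $$ (k, j) = (\<Sum>\<gamma>\<in>?S. of_int (Poly_Mapping.lookup c \<gamma>) * ?h \<gamma>)"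
    if "Poly_Mapping.keys c \<subseteq> ?S" for c
    using kj frag_sum_superset[OF _ that, of ?h] by (simp add: Phi_def mult.assoc)
  show "Phi d \<phi> (a - b) $$ (k, j) = (Phi d \<phi> a - Phi d \<phi> b) $$ (k, j)"
    using kj eq[OF keys_diff] eq[of a] eq[of b]
    by (simp add: carrier_matD[OF Phi_carrier] lookup_minus left_diff_distrib sum_subtractf)
qed (simp_all add: Phi_def)

lemma Phi_zero: "Phi d \<phi> 0 = 0\<^sub>m d d"
  by (auto simp: Phi_def intro!: eq_matI)

lemma Phi_uminus: "Phi d \<phi> (- c) = - Phi d \<phi> c"
  using Phi_diff[of d \<phi> 0 c] by (auto simp: Phi_zero Phi_def intro!: eq_matI)

lemma Phi_add: "Phi d \<phi> (a + b) = Phi d \<phi> a + Phi d \<phi> b"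
proof -
  have "Phi d \<phi> (a + b) = Phi d \<phi> a - (- Phi d \<phi> b)"
    using Phi_diff[of d \<phi> a "- b"] by (simp add: Phi_uminus)
  also have "\<dots> = Phi d \<phi> a + Phi d \<phi> b"
    by (auto simp: Phi_def intro!: eq_matI)
  finally show ?thesis .
qed

lemma Phi_frag_of:
  "Phi d \<phi> (frag_of \<gamma>) = Matrix.mat d d (\<lambda>(k, j). var_t powi (alpha \<gamma>) * cst (\<phi> \<gamma> $$ (k, j)))"
  by (auto simp: Phi_def cst_def)

text \<open>Guarantees that every group element occurring in a Fox derivative is represented by a
  word; the induction in \<open>Phi_left_mult\<close> picks such representatives.\<close>

lemma keys_fox: "Poly_Mapping.keys (fox x w) \<subseteq> carrier free_group"
proof (induction w)
  case (Cons s w)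
  let ?mul = "\<lambda>h. word_class {} [s] \<otimes>\<^bsub>free_group\<^esub> h"
  have "?mul h \<in> carrier free_group" if "h \<in> carrier free_group" for h
    using that by (auto simp: presented_group_def[THEN arg_cong[of _ _ carrier]] presented_group_mult)
  then have "Poly_Mapping.keys (frag_extend (\<lambda>h. frag_of (?mul h)) (fox x w)) \<subseteq> carrier free_group"
    using keys_frag_extend[of "\<lambda>h. frag_of (?mul h)" "fox x w"] Cons by (auto split: if_splits)
  moreover have "\<one>\<^bsub>free_group\<^esub> \<in> carrier free_group" "word_class {} [s] \<in> carrier free_group"
    by (auto simp: presented_group_def)
  ultimately show ?case
    by (auto dest!: subsetD[OF keys_add] subsetD[OF keys_diff] split: if_splits)
qed simp

section \<open>From words to the knot group and to matrices\<close>

definition knot_class :: "nat \<Rightarrow> nat \<Rightarrow> lin_gen word \<Rightarrow> lin_gen word set" where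
  "knot_class m n = word_class (lin_relations m n)"

lemma knot_class_carrier [simp]: "knot_class m n w \<in> carrier (knot_group m n)"
  by (simp add: knot_class_def knot_group_def presented_group_def)

lemma knot_class_append: "knot_class m n (u @ v) = knot_class m n u \<otimes>\<^bsub>knot_group m n\<^esub> knot_class m n v"
  by (simp add: knot_class_def knot_group_def presented_group_mult)

lemma knot_class_Nil: "knot_class m n [] = \<one>\<^bsub>knot_group m n\<^esub>"
  by (simp add: knot_class_def knot_group_def presented_group_def)

lemma group_knot_group: "group (knot_group m n)"
  by (simp add: knot_group_def group_presented_group)

lemma knot_class_letter: "knot_class m n [(g, True)] = knot_gen m n g"
  by (simp add: knot_class_def knot_gen_def gen_class_def)

lemma knot_class_inverse_letter: "knot_class m n [(g, False)] = inv\<^bsub>knot_group m n\<^esub> knot_gen m n g"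
proof -
  interpret group "knot_group m n" by (rule group_knot_group)
  have "knot_class m n [(g, False)] \<otimes>\<^bsub>knot_group m n\<^esub> knot_gen m n g = \<one>\<^bsub>knot_group m n\<^esub>"
    using pres_eq.cancel[of "lin_relations m n" g False]
    by (simp only: knot_class_append [symmetric] knot_class_letter [symmetric] knot_class_Nil [symmetric])
      (simp add: word_class_eq knot_class_def)
  then show ?thesis
    using knot_class_carrier[of m n] by (intro inv_equality [symmetric]) (simp_all flip: knot_class_letter)
qed

lemma word_eval_knot_gen: "word_eval (knot_group m n) (knot_gen m n) w = knot_class m n w"
proof (induction w)
  case (Cons s w)
  obtain g b where s: "s = (g, b)" by fastforce
  have "knot_class m n (s # w) = knot_class m n [s] \<otimes>\<^bsub>knot_group m n\<^esub> knot_class m n w"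
    by (simp flip: knot_class_append)
  then show ?case
    using Cons by (cases b) (simp_all add: s knot_class_letter knot_class_inverse_letter)
qed (simp add: knot_class_Nil)

text \<open>Words equal in the free group are equal in the knot group, so the representative chosen
  in \<open>gen_lift\<close> can be replaced by any given one.\<close>

lemma gen_lift_knot_gen:
  "gen_lift (knot_group m n) (knot_gen m n) (word_class {} w) = knot_class m n w"
  by (subst gen_lift_word_class)
    (auto simp: group_knot_group word_eval_knot_gen simp flip: knot_class_letter)

text \<open>Here \<open>a\<close> stands for \<open>\<xi> ^ i\<close>. The determinant computation
  uses \<open>root\<close> alone; the exact order of \<open>a\<close> enters with the averaging over
  a period. The dimension of the composed representation is \<open>2 * N\<close>.\<close>

locale metabelian_rep =
  fixes m n N :: nat and a :: complex and \<rho> :: "lin_gen word set \<Rightarrow> complex mat"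
  assumes root: "a ^ (4 * m * n + 1) = 1"
    and hom: "\<rho> \<in> hom (knot_group m n) (SL 2)"
    and rho_X1: "\<rho> (knot_gen m n X1) = mat2 a 0 0 (inverse a)"
    and rho_X2: "\<rho> (knot_gen m n X2) = mat2 (a ^ (2 * m)) 0 0 (inverse (a ^ (2 * m)))"
    and rho_Mu: "\<rho> (knot_gen m n Mu) = mat2 0 1 (- 1) 0"
begin

lemma a_nonzero [simp]: "a \<noteq> 0"
  using root by (auto simp: power_0_left)

abbreviation "d \<equiv> 2 * N"

definition Psi :: "lin_gen word \<Rightarrow> complex poly fract mat" where
  "Psi w = Phi d (sigma d \<circ> \<rho>) (frag_of (knot_class m n w))"

definition Fox :: "lin_gen \<Rightarrow> lin_gen word \<Rightarrow> complex poly fract mat" where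
  "Fox x w = Phi d (sigma d \<circ> \<rho>) (to_knot_ring m n (fox x w))"

lemma Psi_carrier [simp]: "Psi w \<in> carrier_mat d d"
  by (simp add: Psi_def)

lemma Fox_carrier [simp]: "Fox x w \<in> carrier_mat d d"
  by (simp add: Fox_def)

lemma rho_append:
  "\<rho> (knot_class m n (u @ v)) = \<rho> (knot_class m n u) * \<rho> (knot_class m n v)"
  using hom_mult[OF hom, of "knot_class m n u" "knot_class m n v"]
  by (simp add: knot_class_append SL_def)

lemma group_hom_rho: "group_hom (knot_group m n) (SL 2) \<rho>"
  by (simp add: group_hom_def group_hom_axioms_def group_knot_group group_SL hom)

lemma rho_Nil: "\<rho> (knot_class m n []) = 1\<^sub>m 2"
  using group_hom.hom_one[OF group_hom_rho] by (simp add: knot_class_Nil SL_def)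

lemma rho_inverse_letter: "\<rho> (knot_class m n [(g, False)]) = inv\<^bsub>SL 2\<^esub> \<rho> (knot_gen m n g)"
  unfolding knot_class_inverse_letter
  by (rule group_hom.hom_inv[OF group_hom_rho]) (simp flip: knot_class_letter)

lemma rho_gen: "\<rho> (knot_gen m n g) \<in> monomial_SL2"
  using monomial_SL2_diag[of a] monomial_SL2_diag[of "a ^ (2 * m)"] monomial_SL2_antidiag[of 1]
  by (cases g) (simp_all add: rho_X1 rho_X2 rho_Mu)

lemma rho_monomial: "\<rho> (knot_class m n w) \<in> monomial_SL2"
proof (induction w)
  case Nil
  then show ?case
    using monomial_SL2_diag[of 1] by (simp add: rho_Nil mat2_one)
next
  case (Cons s w)
  obtain g b where s: "s = (g, b)" by fastforce
  have "\<rho> (knot_class m n [s]) \<in> monomial_SL2"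
    using rho_gen[of g] by (cases b) (simp_all add: s knot_class_letter rho_inverse_letter monomial_SL2_inv)
  then show ?case
    using monomial_SL2_closed[OF _ Cons] rho_append[of "[s]" w] by simp
qed

lemma alpha_append: "alpha (knot_class m n (u @ v)) = alpha (knot_class m n u) + alpha (knot_class m n v)"
  using hom_mult[OF alpha_hom(1), of "knot_class m n u" m n "knot_class m n v"]
  by (simp add: knot_class_append integer_group_def)

lemma Psi_eq:
  "Psi w = var_t powi (alpha (knot_class m n w)) \<cdot>\<^sub>m map_mat cst (sigma d (\<rho> (knot_class m n w)))"
  by (rule eq_matI) (auto simp: Psi_def Phi_frag_of sigma_def)

lemma Psi_append: "Psi (u @ v) = Psi u * Psi v"
proof -
  let ?s = "\<lambda>w. sigma d (\<rho> (knot_class m n w))"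
  let ?t = "\<lambda>w. var_t powi (alpha (knot_class m n w))"
  have c: "?s w \<in> carrier_mat d d" for w by (simp add: sigma_def)
  have "?t (u @ v) \<cdot>\<^sub>m map_mat cst (?s u * ?s v) =
      (?t u \<cdot>\<^sub>m map_mat cst (?s u)) * (?t v \<cdot>\<^sub>m map_mat cst (?s v))"
    using c[of u] c[of v]
    by (auto simp: scalar_prod_def alpha_append power_int_add sum_distrib_left mult_ac
        intro!: eq_matI sum.cong)
  then show ?thesis
    by (simp add: Psi_eq rho_append sigma_mult rho_monomial)
qed

lemma Psi_Nil: "Psi [] = 1\<^sub>m d"
proof -
  have "alpha (knot_class m n []) = 0"
    using alpha_append[of "[]" "[]"] by simp
  moreover have "sigma d (1\<^sub>m 2) = 1\<^sub>m d"
    using sigma_diag[of 1 d] by (simp add: mat2_one xmat_one[of d])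
  ultimately show ?thesis
    by (simp add: Psi_eq rho_Nil) (auto intro!: eq_matI)
qed

lemma to_knot_ring_simps:
  "to_knot_ring m n 0 = 0" "to_knot_ring m n (u + v) = to_knot_ring m n u + to_knot_ring m n v"
  "to_knot_ring m n (u - v) = to_knot_ring m n u - to_knot_ring m n v"
  "to_knot_ring m n (- u) = - to_knot_ring m n u"
  "to_knot_ring m n (frag_of (word_class {} w)) = frag_of (knot_class m n w)"
  by (simp_all add: to_knot_ring_def frag_extend_add frag_extend_minus frag_extend_diff gen_lift_knot_gen)

text \<open>Both sides are additive in \<open>c\<close>, and on a single group element the claim is
  the multiplicativity of \<open>Psi\<close>. This turns the recursion defining \<open>fox\<close>
  into one for matrices.\<close>

lemma Phi_left_mult:
  assumes "Poly_Mapping.keys c \<subseteq> carrier free_group"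
  shows "Phi d (sigma d \<circ> \<rho>) (to_knot_ring m n
      (frag_extend (\<lambda>h. frag_of (word_class {} u \<otimes>\<^bsub>free_group\<^esub> h)) c)) =
    Psi u * Phi d (sigma d \<circ> \<rho>) (to_knot_ring m n c)"
  using assms
proof (induction c rule: frag_induction)
  case zero
  then show ?case
    by (simp add: to_knot_ring_simps Phi_zero right_mult_zero_mat[OF Psi_carrier])
next
  case (one x)
  then obtain v where "x = word_class {} v" by (auto simp: presented_group_def)
  then show ?case
    by (simp only: frag_extend_of presented_group_mult to_knot_ring_simps Psi_append Psi_def [symmetric])
next
  case (diff c c')
  then show ?case
    by (simp add: frag_extend_diff to_knot_ring_simps Phi_diff mult_minus_distrib_mat[of _ d d _ d])
qed

lemma Fox_Nil: "Fox x [] = 0\<^sub>m d d"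
  by (simp add: Fox_def to_knot_ring_simps Phi_zero)

lemma Fox_Cons:
  "Fox x (s # w) = (if fst s = x then if snd s then 1\<^sub>m d else - Psi [s] else 0\<^sub>m d d)
     + Psi [s] * Fox x w"
proof -
  have "\<one>\<^bsub>free_group\<^esub> = word_class {} ([] :: lin_gen word)"
    by (simp add: presented_group_def)
  then show ?thesis
    by (simp add: Fox_def to_knot_ring_simps Phi_add Phi_left_mult[OF keys_fox] Phi_uminus Phi_zero
        flip: Psi_def Psi_Nil)
qed

text \<open>The product rule of Fox calculus. It lets the relators be differentiated subword by
  subword, with powers of generators as units.\<close>

lemma Fox_append: "Fox x (u @ v) = Fox x u + Psi u * Fox x v"
proof (induction u)
  case Nil
  show ?case
    by (simp add: Fox_Nil Psi_Nil left_add_zero_mat[OF Fox_carrier] left_mult_one_mat[OF Fox_carrier])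
next
  case (Cons s u)
  let ?E = "if fst s = x then if snd s then 1\<^sub>m d else - Psi [s] else 0\<^sub>m d d"
  have E: "?E \<in> carrier_mat d d" by simp
  note c = mult_carrier_mat[OF Psi_carrier Fox_carrier]
  have "Fox x ((s # u) @ v) = ?E + (Psi [s] * Fox x u + Psi [s] * (Psi u * Fox x v))"
    by (simp only: append_Cons Fox_Cons Cons mult_add_distrib_mat[OF Psi_carrier Fox_carrier c])
  also have "Psi [s] * (Psi u * Fox x v) = Psi (s # u) * Fox x v"
    using Psi_append[of "[s]" u] by (simp add: assoc_mult_mat[OF Psi_carrier Psi_carrier Fox_carrier])
  also have "?E + (Psi [s] * Fox x u + Psi (s # u) * Fox x v) = Fox x (s # u) + Psi (s # u) * Fox x v"
    by (simp only: Fox_Cons assoc_add_mat[OF E c c])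
  finally show ?case .
qed

end

text \<open>The eigenvalue of the derivative of the \<open>m\<close>-th power of \<open>X1\<close>,
  where \<open>X1\<close> acts by \<open>z\<close>.\<close>

definition geom1 :: "nat \<Rightarrow> complex \<Rightarrow> complex" where
  "geom1 m z = (\<Sum>l<m. z ^ l)"

text \<open>The sum is the eigenvalue of the derivative of the \<open>n\<close>-th power of
  \<open>X2\<close>, which acts by \<open>z ^ (2 * m)\<close>. The factor \<open>z ^ m\<close> comes
  from inverting the pivot block of the Fox matrix.\<close>

definition geom2 :: "nat \<Rightarrow> nat \<Rightarrow> complex \<Rightarrow> complex" where
  "geom2 m n z = z ^ m * (\<Sum>l<n. (z ^ (2 * m)) ^ l)"

text \<open>The common coefficient of 1 and of the fourth power of t in the numerator on the plane
  with eigenvalues \<open>z\<close> and \<open>inverse z\<close>; \<open>middle_coeff\<close> is the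
  coefficient of the square of t.\<close>

definition outer_coeff :: "nat \<Rightarrow> nat \<Rightarrow> complex \<Rightarrow> complex" where
  "outer_coeff m n z = geom1 m z * geom1 m (inverse z) * geom2 m n z * geom2 m n (inverse z)"

definition middle_coeff :: "nat \<Rightarrow> nat \<Rightarrow> complex \<Rightarrow> complex" where
  "middle_coeff m n z =
     1 + (geom2 m n z + geom2 m n (inverse z)) *
         (z ^ (2 * m * n) * geom1 m (inverse z) + inverse z ^ (2 * m * n) * geom1 m z)
       + 2 * outer_coeff m n z"

section \<open>Images and Fox derivatives of the generators and their powers\<close>

lemma smult_map_xmat:
  "c \<cdot>\<^sub>m map_mat cst (xmat k f g) = xmat k (\<lambda>j. c * cst (f j)) (\<lambda>j. c * cst (g j))"
  by (auto simp: xmat_def distrib_left intro!: eq_matI)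

lemma powi_power: "(b ^ k) powi i = (b powi i) ^ k" for b :: "'b::field"
  by (simp flip: power_int_of_nat power_int_mult add: mult.commute)

lemma word_pow_Suc: "word_pow w (Suc k) = w @ word_pow w k"
  by (simp add: word_pow_def)

lemma word_pow_0: "word_pow w 0 = []"
  by (simp add: word_pow_def)

lemma word_inv_append: "word_inv (u @ v) = word_inv v @ word_inv u"
  by (simp add: word_inv_def)

lemma sum_powers_Suc: "(\<Sum>l<Suc k. x ^ l) = 1 + x * (\<Sum>l<k. x ^ l)" for x :: "'b::comm_ring_1"
  by (simp add: sum.lessThan_Suc_shift sum_distrib_left del: sum.lessThan_Suc)

context metabelian_rep
begin

definition eigval :: "nat \<Rightarrow> complex" where
  "eigval j = a powi (2 * int j - int (d - 1))"

definition eps :: "nat \<Rightarrow> complex poly fract" where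
  "eps j = (- 1) ^ (d - 1 - j)"

lemma eigval_nonzero [simp]: "eigval j \<noteq> 0"
  by (simp add: eigval_def)

lemma eigval_rev: "j < d \<Longrightarrow> eigval (d - Suc j) = inverse (eigval j)"
proof -
  assume "j < d"
  then have eq: "2 * int (d - Suc j) - int (d - 1) = - (2 * int j - int (d - 1))" by auto
  show ?thesis unfolding eigval_def eq by (rule power_int_minus)
qed

lemma eigval_root: "eigval j ^ (4 * m * n + 1) = 1"
proof -
  have "eigval j ^ (4 * m * n + 1) = (a powi (2 * int j - int (d - 1))) powi int (4 * m * n + 1)"
    by (simp only: eigval_def power_int_of_nat)
  also have "\<dots> = (a powi int (4 * m * n + 1)) powi (2 * int j - int (d - 1))"
    by (simp only: power_int_mult [symmetric] mult.commute)
  also have "a powi int (4 * m * n + 1) = 1"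
    using root by (simp only: power_int_of_nat)
  finally show ?thesis by simp
qed

text \<open>Since \<open>d - 1\<close> is odd, \<open>j\<close> and its reverse have opposite
  parities. This is what makes the sign in \<open>1 + var_t\<^sup>2\<close> positive.\<close>

lemma eps_rev: "j < d \<Longrightarrow> eps (d - Suc j) = - eps j"
proof -
  assume "j < d"
  then have "d - 1 - (d - Suc j) = j" "even (d - 1 - j) \<longleftrightarrow> odd j" by auto
  then show ?thesis by (cases "even j") (simp_all only: eps_def, simp_all)
qed

lemma eps_square [simp]: "eps j * eps j = 1"
  by (simp add: eps_def flip: power_mult_distrib)

lemma Psi_X1: "Psi [(X1, True)] = xmat d (\<lambda>j. cst (eigval j)) (\<lambda>_. 0)"
  by (simp add: Psi_eq alpha_hom(2-4)[of m n] knot_class_letter rho_X1 sigma_diag smult_map_xmat eigval_def)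

lemma Psi_X2: "Psi [(X2, True)] = xmat d (\<lambda>j. cst (eigval j) ^ (2 * m)) (\<lambda>_. 0)"
  using sigma_diag[of "a ^ (2 * m)" d]
  by (simp add: Psi_eq alpha_hom(2-4)[of m n] knot_class_letter rho_X2 smult_map_xmat eigval_def powi_power)

lemma Psi_Mu: "Psi [(Mu, True)] = xmat d (\<lambda>_. 0) (\<lambda>j. var_t * eps j)"
  using sigma_antidiag[of 1 d]
  by (simp add: Psi_eq alpha_hom(2-4)[of m n] knot_class_letter rho_Mu smult_map_xmat eps_def)

lemma Psi_inverse_letter: "Psi [(g, False)] * Psi [(g, True)] = 1\<^sub>m d"
proof -
  have "knot_class m n ([(g, False)] @ [(g, True)]) = knot_class m n []"
    using pres_eq.cancel[of "lin_relations m n" g False]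
    by (simp add: word_class_eq knot_class_def)
  then have "Psi ([(g, False)] @ [(g, True)]) = Psi []"
    by (simp only: Psi_def)
  then show ?thesis
    by (simp only: Psi_append Psi_Nil)
qed

lemma Psi_inverse_letter_eqI:
  assumes "Psi [(g, True)] * B = 1\<^sub>m d" "B \<in> carrier_mat d d"
  shows "Psi [(g, False)] = B"
proof -
  have "Psi [(g, False)] = Psi [(g, False)] * (Psi [(g, True)] * B)"
    by (simp add: assms(1) right_mult_one_mat[OF Psi_carrier])
  also have "\<dots> = B"
    using assoc_mult_mat[OF Psi_carrier Psi_carrier assms(2)] assms(2)
    by (simp add: Psi_inverse_letter flip: assoc_mult_mat[OF Psi_carrier Psi_carrier assms(2)])
  finally show ?thesis .
qed

lemma Psi_inverse_diag:
  assumes "Psi [(g, True)] = xmat d F (\<lambda>_. 0)" "\<And>j. j < d \<Longrightarrow> F j \<noteq> 0"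
  shows "Psi [(g, False)] = xmat d (\<lambda>j. inverse (F j)) (\<lambda>_. 0)"
  by (rule Psi_inverse_letter_eqI)
    (auto simp: assms xmat_mult xmat_one intro!: xmat_cong)

lemma Psi_Mu_inverse: "Psi [(Mu, False)] = xmat d (\<lambda>_. 0) (\<lambda>j. - eps j / var_t)"
  by (rule Psi_inverse_letter_eqI)
    (auto simp: Psi_Mu xmat_mult xmat_one eps_rev intro!: xmat_cong)

lemma Psi_pow:
  assumes "Psi [(g, True)] = xmat d F (\<lambda>_. 0)"
  shows "Psi (word_pow (letter g) k) = xmat d (\<lambda>j. F j ^ k) (\<lambda>_. 0)"
proof (induction k)
  case (Suc k)
  show ?case
    unfolding word_pow_Suc Psi_append Suc assms xmat_mult by simp
qed (simp add: word_pow_0 Psi_Nil xmat_one[of d])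

lemma Fox_pow:
  assumes "Psi [(g, True)] = xmat d F (\<lambda>_. 0)"
  shows "Fox g (word_pow (letter g) k) = xmat d (\<lambda>j. \<Sum>l<k. F j ^ l) (\<lambda>_. 0)"
proof (induction k)
  case (Suc k)
  then show ?case
    by (simp add: word_pow_Suc Fox_Cons xmat_one[of d] xmat_mult xmat_add assms sum_powers_Suc del: sum.lessThan_Suc)
qed (simp add: word_pow_0 Fox_Nil xmat_zero[of d])

lemma Fox_pow_other:
  assumes "g \<noteq> x"
  shows "Fox x (word_pow (letter g) k) = xmat d (\<lambda>_. 0) (\<lambda>_. 0)"
proof (induction k)
  case (Suc k)
  then show ?case
    using assms by (simp add: word_pow_Suc Fox_Cons right_mult_zero_mat[OF Psi_carrier] flip: xmat_zero[of d])
qed (simp add: word_pow_0 Fox_Nil xmat_zero[of d])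

text \<open>The product rule applied to a power times its inverse, a word representing 1, predicts
  the second formula: minus the inverse power times the derivative of the power.\<close>

lemma Psi_Fox_inverse_pow:
  assumes F: "Psi [(g, True)] = xmat d F (\<lambda>_. 0)" "\<And>j. j < d \<Longrightarrow> F j \<noteq> 0"
  shows "Psi (word_inv (word_pow (letter g) k)) = xmat d (\<lambda>j. inverse (F j ^ k)) (\<lambda>_. 0)"
    and "Fox g (word_inv (word_pow (letter g) k)) =
      xmat d (\<lambda>j. - (\<Sum>l<k. F j ^ l) * inverse (F j ^ k)) (\<lambda>_. 0)"
    and "g \<noteq> x \<Longrightarrow> Fox x (word_inv (word_pow (letter g) k)) = xmat d (\<lambda>_. 0) (\<lambda>_. 0)"
proof -
  have inv_Suc: "word_inv (word_pow (letter g) (Suc k)) = word_inv (word_pow (letter g) k) @ [(g, False)]" for k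
    by (simp only: word_pow_Suc word_inv_append) (simp add: word_inv_def)
  have zero: "word_inv (word_pow (letter g) 0) = []"
    by (simp add: word_pow_0 word_inv_def)
  note inv = Psi_inverse_diag[OF F]
  have Fox1: "Fox g [(g, False)] = xmat d (\<lambda>j. - inverse (F j)) (\<lambda>_. 0)"
    by (simp add: Fox_Cons Fox_Nil inv xmat_uminus xmat_zero[of d] xmat_mult xmat_add)
  have Fox2: "Fox x [(g, False)] = xmat d (\<lambda>_. 0) (\<lambda>_. 0)" if "g \<noteq> x"
    using that by (simp add: Fox_Cons Fox_Nil inv xmat_zero[of d] xmat_mult xmat_add)
  show P: "Psi (word_inv (word_pow (letter g) k)) = xmat d (\<lambda>j. inverse (F j ^ k)) (\<lambda>_. 0)" for k
    by (induction k) (simp_all add: zero inv_Suc Psi_Nil Psi_append inv xmat_one[of d] xmat_mult mult.commute[of "inverse (F j)" for j])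
  show "Fox g (word_inv (word_pow (letter g) k)) =
      xmat d (\<lambda>j. - (\<Sum>l<k. F j ^ l) * inverse (F j ^ k)) (\<lambda>_. 0)"
  proof (induction k)
    case (Suc k)
    show ?case
      unfolding inv_Suc Fox_append Suc P Fox1 xmat_mult xmat_add
      by (rule xmat_cong) (simp_all add: F(2) sum_powers_Suc field_simps del: sum.lessThan_Suc)
  qed (simp add: zero Fox_Nil xmat_zero[of d])
  show "Fox x (word_inv (word_pow (letter g) k)) = xmat d (\<lambda>_. 0) (\<lambda>_. 0)" if "g \<noteq> x"
    by (induction k) (simp_all add: zero inv_Suc Fox_Nil Fox_append P Fox2[OF that] xmat_zero[of d] xmat_mult xmat_add)
qed

end

section \<open>The Fox matrix of the presentation and its determinant\<close>

lemma word_inv_letter: "word_inv (letter g) = [(g, False)]"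
  by (simp add: word_inv_def)

text \<open>The determinant on one plane after the Schur reduction. The squares of \<open>q\<close>
  and \<open>q'\<close> in the first product cancel against those in
  \<open>(q + q')\<^sup>2\<close>, which leaves a palindromic polynomial in
  \<open>T\<close>.\<close>

lemma factor_identity:
  fixes T e q q' s s' D D' :: "'a::idom"
  assumes "e * e = 1" and "D * D' = 1"
  shows "(T\<^sup>2 * q' - q) * s * ((T\<^sup>2 * q - q') * s')
      - T * e * (D + (q + q') * s) * (T * (- e) * (D' + (q' + q) * s')) =
    s * s' * q * q' * (1 + T ^ 4)
      + (1 + (q + q') * (D * s' + D' * s) + 2 * (s * s' * q * q')) * T\<^sup>2"
proof -
  have "(T\<^sup>2 * q' - q) * s * ((T\<^sup>2 * q - q') * s')
      - T * e * (D + (q + q') * s) * (T * (- e) * (D' + (q' + q) * s')) =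
    (T\<^sup>2 * q' - q) * s * ((T\<^sup>2 * q - q') * s')
      + (e * e) * T\<^sup>2 * (D * D' + (q + q') * (D * s' + D' * s) + (q + q')\<^sup>2 * s * s')"
    by (simp add: algebra_simps power2_eq_square)
  then show ?thesis
    unfolding assms by (simp add: algebra_simps power2_eq_square power4_eq_xxxx)
qed

context metabelian_rep
begin

definition S1 :: "nat \<Rightarrow> complex poly fract" where
  "S1 j = (\<Sum>l<m. cst (eigval j) ^ l)"

definition S2 :: "nat \<Rightarrow> complex poly fract" where
  "S2 j = (\<Sum>l<n. (cst (eigval j) ^ (2 * m)) ^ l)"

lemma rev_rev: "j < d \<Longrightarrow> d - Suc (d - Suc j) = j"
  by auto

lemma eps_mult_eps_left [simp]: "eps j * (eps j * x) = x"
  by (simp flip: mult.assoc)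

lemma Fox_letter: "Fox g [(g, True)] = xmat d (\<lambda>_. 1) (\<lambda>_. 0)"
  and Fox_letter_other: "g \<noteq> x \<Longrightarrow> Fox x [(g, b)] = xmat d (\<lambda>_. 0) (\<lambda>_. 0)"
  by (simp_all add: Fox_Cons Fox_Nil xmat_one[of d] right_mult_zero_mat[OF Psi_carrier]
      flip: xmat_zero[of d])

lemma cst_eigval_nonzero: "cst (eigval j) \<noteq> 0" "cst (eigval j) ^ k \<noteq> 0"
  by simp_all

lemmas Psi_letters = Psi_X1 Psi_X2 Psi_Mu Psi_Mu_inverse
  Psi_pow[OF Psi_X1] Psi_pow[OF Psi_X2]
  Psi_Fox_inverse_pow(1)[OF Psi_X1 cst_eigval_nonzero(1)]
  Psi_Fox_inverse_pow(1)[OF Psi_X2 cst_eigval_nonzero(2)]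

lemmas Fox_letters = Fox_letter Fox_letter_other Fox_pow_other
  Fox_pow[OF Psi_X1] Fox_pow[OF Psi_X2]
  Psi_Fox_inverse_pow(2,3)[OF Psi_X1 cst_eigval_nonzero(1)]
  Psi_Fox_inverse_pow(2,3)[OF Psi_X2 cst_eigval_nonzero(2)]

text \<open>Conjugation by \<open>Mu\<close> inverts the eigenvalue z of \<open>X1\<close>, so the
  prefix before the inverse power acts by z to the power \<open>- m + 2 * m\<close>. This cancels
  the power \<open>- m\<close> in the derivative of the inverse power and leaves
  \<open>- S1 j\<close>.\<close>

lemma Fox_relator1_X1:
  "Fox X1 (relator1 m) = xmat d (\<lambda>j. - S1 j) (\<lambda>j. var_t * eps j * S1 j)"
  unfolding relator1_def word_inv_letter Fox_append
  by (simp add: Fox_letters Psi_letters S1_def S2_def xmat_mult xmat_add)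
    (rule xmat_cong; simp add: eps_rev rev_rev eigval_rev; simp add: field_simps power_add mult_2_right)

lemma Fox_relator1_X2:
  "Fox X2 (relator1 m) = xmat d (\<lambda>j. inverse (cst (eigval j)) ^ m) (\<lambda>_. 0)"
  unfolding relator1_def word_inv_letter Fox_append
  by (simp add: Fox_letters Psi_letters S1_def S2_def xmat_mult xmat_add)
    (rule xmat_cong; simp add: eps_rev rev_rev eigval_rev; simp add: field_simps)

lemma Fox_relator2_X1:
  "Fox X1 (relator2 n) = xmat d (\<lambda>_. 0) (\<lambda>j. var_t * eps j * cst (eigval j) ^ (2 * m * n))"
  unfolding relator2_def word_inv_letter Fox_append
  by (simp add: Fox_letters Psi_letters S1_def S2_def xmat_mult xmat_add)
    (rule xmat_cong; simp add: eps_rev rev_rev eigval_rev power_mult)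

lemma Fox_relator2_X2:
  "Fox X2 (relator2 n) = xmat d (\<lambda>j. - S2 j) (\<lambda>j. var_t * eps j * S2 j)"
proof -
  \<comment> \<open>The prefix before the inverse power of \<open>X2\<close> contributes the
    exponent \<open>- (2 * m * n + 1)\<close>, and the derivative of that power contributes
    \<open>- 2 * m * n\<close>. Together they give an exponent that is trivial because the
    eigenvalue is a root of unity of order dividing \<open>4 * m * n + 1\<close>.\<close>
  have root: "inverse (cst (eigval j)) * inverse (cst (eigval j) ^ (2 * m)) ^ n * inverse ((cst (eigval j) ^ (2 * m)) ^ n) = 1"
    for j
  proof -
    have "cst (eigval j) * ((cst (eigval j) ^ (2 * m)) ^ n * (cst (eigval j) ^ (2 * m)) ^ n) = cst (eigval j ^ (4 * m * n + 1))"
      by (simp add: mult_ac flip: power_mult power_add)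
    also have "\<dots> = 1" by (simp only: eigval_root cst_simps)
    finally show ?thesis
      by (simp add: power_inverse flip: inverse_mult_distrib) (simp add: mult_ac)
  qed
  show ?thesis
    unfolding relator2_def word_inv_letter Fox_append
    apply (simp add: Fox_letters Psi_letters S1_def S2_def xmat_mult xmat_add)
    apply (rule xmat_cong; simp add: eps_rev rev_rev eigval_rev)
    subgoal for j using root[of j] by (simp add: mult_ac power_inverse)
    done
qed

lemma det_Phi_one_minus_Mu:
  "Determinant.det (Phi d (sigma d \<circ> \<rho>)
      (frag_of \<one>\<^bsub>knot_group m n\<^esub> - frag_of (knot_gen m n Mu))) = (1 + var_t\<^sup>2) ^ N"
proof -
  have "Phi d (sigma d \<circ> \<rho>) (frag_of \<one>\<^bsub>knot_group m n\<^esub> - frag_of (knot_gen m n Mu)) =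
      Psi [] - Psi [(Mu, True)]"
    by (simp only: Phi_diff Psi_def knot_class_Nil knot_class_letter)
  also have "\<dots> = xmat d (\<lambda>_. 1) (\<lambda>j. - (var_t * eps j))"
    by (simp add: Psi_Nil Psi_Mu xmat_one[of d] xmat_minus)
  finally have "Determinant.det (Phi d (sigma d \<circ> \<rho>)
      (frag_of \<one>\<^bsub>knot_group m n\<^esub> - frag_of (knot_gen m n Mu))) =
      (\<Prod>j<N. 1 - var_t * eps j * (var_t * eps (d - Suc j)))"
    by (simp add: det_xmat)
  also have "\<dots> = (\<Prod>j<N. 1 + var_t\<^sup>2)"
    by (rule prod.cong; simp add: eps_rev; simp add: power2_eq_square mult_ac)
  finally show ?thesis by simp
qed

definition factor :: "nat \<Rightarrow> complex poly fract" where
  "factor j = cst (outer_coeff m n (eigval j)) * (1 + var_t ^ 4) + cst (middle_coeff m n (eigval j)) * var_t\<^sup>2"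

lemma det_Fox_matrix:
  "Determinant.det (four_block_mat (Fox X1 (relator1 m)) (Fox X2 (relator1 m))
      (Fox X1 (relator2 n)) (Fox X2 (relator2 n))) = (\<Prod>j<N. factor j)"
proof -
  let ?c = "\<lambda>j. cst (eigval j)"
  let ?B' = "xmat d (\<lambda>j. ?c j ^ m) (\<lambda>_. 0)"
  let ?q = "\<lambda>j. ?c j ^ m * S2 j"
  let ?f = "\<lambda>j. (var_t\<^sup>2 * ?q (d - Suc j) - ?q j) * S1 j"
  let ?h = "\<lambda>j. ?c j ^ (2 * m * n) + (?q j + ?q (d - Suc j)) * S1 j"
  have inv: "Fox X2 (relator1 m) * ?B' = 1\<^sub>m d"
    unfolding Fox_relator1_X2 xmat_mult xmat_one[of d]
    by (rule xmat_cong) (simp_all add: power_inverse)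
  \<comment> \<open>The entries at \<open>j\<close> and at its reverse are inverse to each other,
    and the signs cancel in pairs.\<close>
  have "Determinant.det (- Fox X2 (relator1 m)) = (\<Prod>j<N. 1)"
    unfolding Fox_relator1_X2 xmat_uminus det_xmat
    by (rule prod.cong) (simp_all add: eigval_rev power_inverse)
  \<comment> \<open>The Schur complement is again supported on the two diagonals; the reversed
    indices come from moving diagonal matrices past antidiagonal ones.\<close>
  moreover have "Fox X1 (relator2 n) - Fox X2 (relator2 n) * (?B' * Fox X1 (relator1 m)) =
      xmat d ?f (\<lambda>j. var_t * eps j * ?h j)"
    unfolding Fox_relator1_X1 Fox_relator2_X1 Fox_relator2_X2 xmat_mult xmat_minus
    by (rule xmat_cong; simp add: eps_rev rev_rev; simp add: algebra_simps power2_eq_square)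
  moreover have "Determinant.det (xmat d ?f (\<lambda>j. var_t * eps j * ?h j)) = (\<Prod>j<N. factor j)"
    unfolding det_xmat
  proof (rule prod.cong)
    fix j assume "j \<in> {..<N}"
    then have j: "j < d" by simp
    let ?r = "d - Suc j"
    define Q Q' where "Q = ?q j" and "Q' = ?q ?r"
    define D D' where "D = ?c j ^ (2 * m * n)" and "D' = ?c ?r ^ (2 * m * n)"
    have DD: "D * D' = 1"
      by (simp add: D_def D'_def eigval_rev j power_inverse)
    have S: "S1 j = cst (geom1 m (eigval j))" "S1 ?r = cst (geom1 m (inverse (eigval j)))"
      by (simp_all add: S1_def geom1_def eigval_rev j)
    have q: "Q = cst (geom2 m n (eigval j))" "Q' = cst (geom2 m n (inverse (eigval j)))"
      by (simp_all add: Q_def Q'_def S2_def geom2_def eigval_rev j)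
    have W: "cst (outer_coeff m n (eigval j)) = S1 j * S1 ?r * Q * Q'"
      by (simp add: outer_coeff_def S q)
    have V: "cst (middle_coeff m n (eigval j)) = 1 + (Q + Q') * (D * S1 ?r + D' * S1 j) + 2 * (S1 j * S1 ?r * Q * Q')"
      using cst_simps(3)[of 1 1] by (simp add: middle_coeff_def outer_coeff_def S q D_def D'_def eigval_rev j)
    have "?f j * ?f ?r - var_t * eps j * ?h j * (var_t * eps ?r * ?h ?r) =
        S1 j * S1 ?r * Q * Q' * (1 + var_t ^ 4)
          + (1 + (Q + Q') * (D * S1 ?r + D' * S1 j) + 2 * (S1 j * S1 ?r * Q * Q')) * var_t\<^sup>2"
      unfolding rev_rev[OF j] eps_rev[OF j] Q_def [symmetric] Q'_def [symmetric]
        D_def [symmetric] D'_def [symmetric]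
      by (rule factor_identity[OF eps_square DD])
    also have "\<dots> = factor j"
      unfolding factor_def W V ..
    finally show "?f j * ?f (d - 1 - j) - var_t * eps j * ?h j * (var_t * eps (d - 1 - j) * ?h (d - 1 - j)) = factor j"
      by simp
  qed simp
  ultimately show ?thesis
    by (subst det_four_block_mat_schur[OF Fox_carrier Fox_carrier xmat_carrier Fox_carrier Fox_carrier inv]) simp
qed

lemma twisted_alexander_eq:
  "twisted_alexander m n d (sigma d \<circ> \<rho>) = (\<Prod>j<N. factor j) / (1 + var_t\<^sup>2) ^ N"
  using det_Fox_matrix
  by (simp only: twisted_alexander_def Let_def Fox_def det_Phi_one_minus_Mu)

end

section \<open>Values of the factors at roots of unity\<close>

text \<open>Cross-multiplication gives \<open>p * b = a * r\<close>. As \<open>r\<close> does not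
  vanish at \<open>z\<close>, a zero of the reduced denominator there would also be a zero of the
  reduced numerator, against coprimality.\<close>

lemma rat_eval_divide:
  assumes "poly r z \<noteq> 0"
  shows "rat_eval (to_fract p / to_fract r) z = poly p z / poly r z"
proof -
  define x where "x = to_fract p / to_fract r"
  define a b where "a = fst (quot_of_fract x)" and "b = snd (quot_of_fract x)"
  have b: "b \<noteq> 0" and cop: "coprime a b" and x: "x = to_fract a / to_fract b"
    using Fract_quot_of_fract[of x]
    by (simp_all add: a_def b_def coprime_quot_of_fract Fract_conv_to_fract)
  have r: "r \<noteq> 0" using assms by auto
  have "to_fract (p * b) = to_fract (a * r)"
    using x b r unfolding x_def by (simp add: field_simps)
  then have "p * b = a * r" by (simp only: to_fract_eq_iff)
  then have eq: "poly p z * poly b z = poly a z * poly r z"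
    by (metis poly_mult)
  have "poly b z \<noteq> 0"
  proof
    assume "poly b z = 0"
    with eq assms have "poly a z = 0" by simp
    with \<open>poly b z = 0\<close> have "[:- z, 1:] dvd a" "[:- z, 1:] dvd b"
      by (simp_all add: poly_eq_0_iff_dvd)
    with cop have "is_unit [:- z, 1:]" by (rule coprime_common_divisor)
    then show False by (simp add: is_unit_pCons_iff)
  qed
  with eq assms have "poly a z / poly b z = poly p z / poly r z"
    by (simp add: field_simps)
  then show ?thesis
    by (simp add: rat_eval_def a_def b_def x_def)
qed

lemma to_fract_prod: "to_fract (prod f A) = (\<Prod>x\<in>A. to_fract (f x))"
  by (induction A rule: infinite_finite_induct) simp_all

lemma to_fract_power: "to_fract (p ^ k) = to_fract p ^ k"
  by (induction k) simp_all

lemma (in metabelian_rep) rat_eval_twisted_alexander: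
  assumes "1 + x\<^sup>2 \<noteq> 0"
  shows "rat_eval (twisted_alexander m n d (sigma d \<circ> \<rho>)) x =
    (\<Prod>j<N. (outer_coeff m n (eigval j) * (1 + x ^ 4) + middle_coeff m n (eigval j) * x\<^sup>2) / (1 + x\<^sup>2))"
proof -
  let ?P = "\<lambda>j. [:outer_coeff m n (eigval j), 0, middle_coeff m n (eigval j), 0, outer_coeff m n (eigval j):]"
  have "var_t\<^sup>2 = to_fract [:0, 0, 1:]" "var_t ^ 4 = to_fract [:0, 0, 0, 0, 1:]"
    by (simp_all add: var_t_def power2_eq_square power4_eq_xxxx flip: to_fract_mult)
  then have "factor j = to_fract (?P j)" and den: "1 + var_t\<^sup>2 = to_fract [:1, 0, 1:]" for j
    by (simp_all add: factor_def cst_def one_pCons flip: to_fract_1 to_fract_mult to_fract_add)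
  then have "(\<Prod>j<N. factor j) = to_fract (\<Prod>j<N. ?P j)"
    by (simp add: to_fract_prod)
  moreover have "(1 + var_t\<^sup>2) ^ N = to_fract ([:1, 0, 1:] ^ N)"
    unfolding den to_fract_power ..
  moreover have "poly [:1, 0, 1:] x = 1 + x\<^sup>2"
    by (simp add: power2_eq_square)
  moreover have "poly (?P j) x = outer_coeff m n (eigval j) * (1 + x ^ 4) + middle_coeff m n (eigval j) * x\<^sup>2" for j
    by (simp add: power2_eq_square power4_eq_xxxx algebra_simps)
  ultimately show ?thesis
    using assms
    by (simp add: twisted_alexander_eq rat_eval_divide poly_power poly_prod prod_dividef)
qed

section \<open>The coefficients at the trivial and at the nontrivial eigenvalues\<close>

lemma outer_coeff_1: "outer_coeff m n 1 = (of_nat m * of_nat n)\<^sup>2"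
  by (simp add: outer_coeff_def geom1_def geom2_def power2_eq_square)

lemma middle_coeff_1: "middle_coeff m n 1 = 2 * (of_nat m * of_nat n)\<^sup>2 + 4 * (of_nat m * of_nat n) + 1"
  unfolding middle_coeff_def outer_coeff_1 by (simp add: geom1_def geom2_def algebra_simps)

text \<open>The four quantities are the closed forms of the geometric sums for eigenvalue
  \<open>x\<^sup>2\<close>, with \<open>y\<close> its \<open>m\<close>-th power and
  \<open>inverse x\<close> its power \<open>2 * m * n\<close>. Everything factors into
  \<open>x - 1\<close>, \<open>1 + x\<close>, \<open>y - 1\<close> and \<open>1 + y\<close>, and the
  two brackets of the second identity are negative reciprocals.\<close>

lemma coeff_identities:
  fixes x y :: "'a::field"
  assumes "x \<noteq> 0" "y \<noteq> 0" "x\<^sup>2 \<noteq> 1" "y\<^sup>2 \<noteq> 1"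
  defines "s \<equiv> (y - 1) / (x\<^sup>2 - 1)" and "s' \<equiv> (inverse y - 1) / (inverse x ^ 2 - 1)"
    and "p \<equiv> y * ((inverse x - 1) / (y\<^sup>2 - 1))" and "p' \<equiv> inverse y * ((x - 1) / (inverse y ^ 2 - 1))"
  shows "s * s' * p * p' = (x / (1 + x)\<^sup>2) * (y / (1 + y)\<^sup>2)"
    and "(p + p') * (inverse x * s' + x * s) = - 1"
proof -
  define A B C D where "A = x - 1" and "B = 1 + x" and "C = y - 1" and "D = 1 + y"
  have nz: "A \<noteq> 0" "B \<noteq> 0" "C \<noteq> 0" "D \<noteq> 0"
    using assms(3,4) by (auto simp: A_def B_def C_def D_def power2_eq_square add_eq_0_iff)
  have xx: "x\<^sup>2 - 1 = A * B" "inverse x ^ 2 - 1 = - (A * B) / x\<^sup>2" "inverse x - 1 = - A / x"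
    and yy: "y\<^sup>2 - 1 = C * D" "inverse y ^ 2 - 1 = - (C * D) / y\<^sup>2" "inverse y - 1 = - C / y"
    using assms(1,2) by (simp_all add: A_def B_def C_def D_def field_simps power2_eq_square)
  have s: "s = C / (A * B)" and p: "p = - (y * A) / (x * C * D)"
    using assms(1) nz by (simp_all add: s_def p_def xx yy flip: A_def C_def)
  have s': "s' = C * x\<^sup>2 / (A * B * y)" and p': "p' = - (y * A) / (C * D)"
    using assms(1,2) nz unfolding s'_def p'_def xx yy
    by (simp_all add: divide_simps flip: A_def) (simp_all add: power2_eq_square)
  show "s * s' * p * p' = (x / (1 + x)\<^sup>2) * (y / (1 + y)\<^sup>2)"
    unfolding s s' p p' B_def [symmetric] D_def [symmetric]
    using assms(1,2) nz by (simp add: divide_simps) (simp add: power2_eq_square mult_ac)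
  have "p + p' = - (y * A * B) / (x * C * D)"
    unfolding p p' B_def using assms(1) nz by (simp add: divide_simps) (simp add: algebra_simps)
  moreover have "inverse x * s' + x * s = (x * C * D) / (y * A * B)"
    unfolding s s' D_def using assms(1,2) nz
    by (simp add: divide_simps) (simp add: algebra_simps power2_eq_square)
  ultimately show "(p + p') * (inverse x * s' + x * s) = - 1"
    using assms(1,2) nz by simp
qed

text \<open>On the unit circle conjugation is inversion, so the square of \<open>1 + u\<close> is
  \<open>u\<close> times the squared norm of \<open>1 + u\<close>.\<close>

lemma root_of_unity_norm_square:
  fixes u :: complex
  assumes "norm u = 1"
  shows "u / (1 + u)\<^sup>2 = of_real (1 / (norm (1 + u))\<^sup>2)"
proof -
  have u: "u * cnj u = 1"
    using assms by (simp add: complex_norm_square [symmetric])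
  have "(1 + u)\<^sup>2 = u * ((1 + u) * cnj (1 + u))"
    using u by (simp add: algebra_simps power2_eq_square)
  moreover have "(1 + u) * cnj (1 + u) = of_real ((norm (1 + u))\<^sup>2)"
    by (rule complex_norm_square [symmetric])
  moreover have "u \<noteq> 0" using assms by auto
  ultimately show ?thesis by simp
qed

text \<open>The exponent is chosen so that \<open>x\<close> is a square root of \<open>z\<close>
  among the roots of unity of odd order: \<open>x\<^sup>2\<close> is the inverse of
  \<open>z ^ (4 * m * n)\<close>, which is \<open>z\<close>. In terms of \<open>x\<close> all
  geometric sums have the closed forms of \<open>coeff_identities\<close>.\<close>

lemma coeffs_root_of_unity:
  fixes z x :: complex
  assumes z: "z ^ (4 * m * n + 1) = 1" "z \<noteq> 1" and x: "x = inverse z ^ (2 * m * n)"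
  shows "outer_coeff m n z = of_real (1 / ((norm (1 + x))\<^sup>2 * (norm (1 + x ^ (2 * m)))\<^sup>2))"
    and "middle_coeff m n z = 2 * outer_coeff m n z"
proof -
  have z0: "z \<noteq> 0" using z(1) by (auto simp: power_0_left)
  have zz: "z * z ^ (4 * m * n) = 1" using z(1) by simp
  have x0: "x \<noteq> 0" using z0 x by simp
  have x2: "x\<^sup>2 = z"
  proof -
    have "x\<^sup>2 = inverse (z ^ (4 * m * n))"
      by (simp add: x power_inverse mult_ac flip: power_mult)
    also have "\<dots> = z" using zz by (metis inverse_unique mult.commute)
    finally show ?thesis .
  qed
  define y where "y = x ^ (2 * m)"
  have y0: "y \<noteq> 0" using x0 by (simp add: y_def)
  have zm: "z ^ m = y" unfolding y_def x2 [symmetric] by (rule power_mult [symmetric])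
  have z2m: "z ^ (2 * m) = y\<^sup>2"
    unfolding zm [symmetric] by (simp only: power_mult [symmetric] mult.commute)
  have zx: "z ^ (2 * m * n) = inverse x" by (simp add: x power_inverse)
  have y2: "y\<^sup>2 \<noteq> 1"
  proof
    assume "y\<^sup>2 = 1"
    then have "inverse x = 1" using zx z2m by (simp add: power_mult)
    with x2 z(2) show False by simp
  qed
  have z': "inverse z \<noteq> 1" using z(2) by simp
  have y2': "inverse z ^ (2 * m) \<noteq> 1" using y2 by (simp add: power_inverse z2m)
  have g1: "geom1 m z = (y - 1) / (x\<^sup>2 - 1)"
    unfolding geom1_def geometric_sum[OF z(2)] zm x2 ..
  have g1': "geom1 m (inverse z) = (inverse y - 1) / (inverse x ^ 2 - 1)"
    unfolding geom1_def geometric_sum[OF z'] power_inverse zm x2 ..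
  have g2: "geom2 m n z = y * ((inverse x - 1) / (y\<^sup>2 - 1))"
    unfolding geom2_def geometric_sum[OF y2[folded z2m]] power_mult [symmetric] zx
    unfolding zm z2m ..
  have g2': "geom2 m n (inverse z) = inverse y * ((x - 1) / (inverse y ^ 2 - 1))"
    unfolding geom2_def geometric_sum[OF y2'] power_mult [symmetric] x [symmetric]
    by (simp only: power_inverse zm z2m)
  have x1: "x\<^sup>2 \<noteq> 1" using x2 z(2) by simp
  note id = coeff_identities[OF x0 y0 x1 y2]
  have "norm z ^ (4 * m * n + 1) = 1 ^ (4 * m * n + 1)"
    using z(1) by (simp only: norm_power [symmetric] norm_one power_one)
  then have "norm z = 1" by (rule power_eq_imp_eq_base) simp_all
  then have nx: "norm x = 1" by (simp add: x norm_power norm_inverse)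
  then have ny: "norm y = 1" by (simp add: y_def norm_power)
  show "outer_coeff m n z = of_real (1 / ((norm (1 + x))\<^sup>2 * (norm (1 + x ^ (2 * m)))\<^sup>2))"
    unfolding outer_coeff_def g1 g1' g2 g2' id(1) root_of_unity_norm_square[OF nx]
      root_of_unity_norm_square[OF ny] by (simp add: y_def)
  have "1 + (geom2 m n z + geom2 m n (inverse z)) *
      (z ^ (2 * m * n) * geom1 m (inverse z) + inverse z ^ (2 * m * n) * geom1 m z) = 0"
    unfolding g1 g1' g2 g2' zx x [symmetric] id(2) by simp
  then show "middle_coeff m n z = 2 * outer_coeff m n z"
    by (simp only: middle_coeff_def) simp
qed

section \<open>Averages over one period\<close>

text \<open>The deviation \<open>v N\<close> of the partial sum from its linear trend is itself
  periodic, hence bounded, and disappears after division by \<open>N\<close>.\<close>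

lemma periodic_average_tendsto:
  fixes u :: "nat \<Rightarrow> real"
  assumes "0 < q" and per: "\<And>k. u (k + q) = u k"
  shows "(\<lambda>N. (\<Sum>k<N. u k) / real N) \<longlonglongrightarrow> (\<Sum>k<q. u k) / real q"
proof -
  define U where "U = (\<Sum>k<q. u k) / real q"
  define v where "v N = (\<Sum>k<N. u k) - real N * U" for N
  have step: "v (N + q) = v N" for N
  proof -
    have shift: "(\<Sum>k<q. u (N + k)) = (\<Sum>k<q. u k)"
    proof (induction N)
      case (Suc N)
      have "(\<Sum>k<q. u (Suc N + k)) + u N = (\<Sum>k<Suc q. u (N + k))"
        by (subst sum.lessThan_Suc_shift) simp
      also have "\<dots> = (\<Sum>k<q. u k) + u N"
        by (simp add: Suc per)
      finally show ?case by simp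
    qed simp
    have "(\<Sum>k<N + q. u k) = (\<Sum>k<N. u k) + (\<Sum>k<q. u (N + k))"
      by (induction q) simp_all
    moreover have "real (N + q) * U = real N * U + (\<Sum>k<q. u k)"
      using \<open>0 < q\<close> by (simp add: U_def distrib_right)
    ultimately show ?thesis by (simp only: v_def shift)
  qed
  have "v (r + l * q) = v r" for l r
  proof (induction l)
    case (Suc l)
    have "r + Suc l * q = (r + l * q) + q" by simp
    then show ?case using Suc step by (simp only:)
  qed simp
  from this[of "N mod q" "N div q" for N] have "v N = v (N mod q)" for N
    by simp
  then have "\<bar>v N\<bar> \<le> Max ((\<lambda>k. \<bar>v k\<bar>) ` {..<q})" (is "_ \<le> ?C") for N
    using \<open>0 < q\<close> by (metis Max_ge finite_imageI finite_lessThan imageI lessThan_iff mod_less_divisor)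
  then have "\<forall>\<^sub>F N in sequentially. norm (v N / real N) \<le> ?C / real N"
    by (intro always_eventually allI) (simp add: divide_right_mono)
  then have "(\<lambda>N. v N / real N) \<longlonglongrightarrow> 0"
    by (rule Lim_null_comparison) (rule lim_const_over_n)
  then have "(\<lambda>N. v N / real N + U) \<longlonglongrightarrow> 0 + U"
    by (intro tendsto_intros)
  moreover have "\<forall>\<^sub>F N in sequentially. v N / real N + U = (\<Sum>k<N. u k) / real N"
    using eventually_gt_at_top[of 0] by eventually_elim (simp add: v_def field_simps)
  ultimately have "(\<lambda>N. (\<Sum>k<N. u k) / real N) \<longlonglongrightarrow> 0 + U"
    by (rule Lim_transform_eventually)
  then show ?thesis by (simp add: U_def)
qed

text \<open>As \<open>2 * k + 1\<close> is odd and below \<open>2 * q\<close>, the only multiple of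
  \<open>q\<close> it can equal is \<open>q\<close> itself, which happens for
  \<open>k = q div 2\<close>.\<close>

lemma not_dvd_odd_number:
  fixes q k :: nat
  assumes "odd q" "k < q" "k \<noteq> q div 2"
  shows "\<not> q dvd 2 * k + 1"
proof
  assume "q dvd 2 * k + 1"
  then obtain c where c: "2 * k + 1 = q * c" ..
  have "odd (q * c)" by (simp flip: c)
  moreover have "q * c < q * 2" unfolding c [symmetric] using assms(2) by auto
  ultimately have "c = 1" using assms(2) by (auto simp: less_2_cases_iff)
  with c assms(1,3) show False by auto
qed

text \<open>Squaring permutes the nontrivial roots of unity of odd order, and
  \<open>(1 + u) (1 - u) = 1 - u\<^sup>2\<close>. The exponent \<open>2 k + 1\<close> runs over all residues, hitting the trivial
  one for \<open>k = q div 2\<close>.\<close>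

lemma prod_one_plus_odd_powers:
  fixes w :: "'a::field"
  assumes "odd q" and ord: "\<And>k. w ^ k = 1 \<longleftrightarrow> q dvd k"
  shows "(\<Prod>k\<in>{..<q} - {q div 2}. 1 + w ^ (2 * k + 1)) = 1"
proof -
  have q: "0 < q" using \<open>odd q\<close> by (auto intro: Nat.gr0I)
  have wq: "w ^ q = 1" by (simp add: ord)
  then have w0: "w \<noteq> 0" using q by (auto simp: power_0_left)
  have eq: "q dvd l - k" if "w ^ k = w ^ l" "k \<le> l" for k l
  proof -
    have "w ^ k * w ^ (l - k) = w ^ l"
      using that(2) by (simp flip: power_add)
    then have "w ^ k * w ^ (l - k) = w ^ k * 1"
      by (simp add: that(1))
    then show ?thesis using w0 by (simp add: ord)
  qed
  have mod: "w ^ k = w ^ (k mod q)" for k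
  proof -
    have "w ^ k = w ^ (q * (k div q) + k mod q)" by simp
    also have "\<dots> = w ^ (k mod q)" unfolding power_add power_mult wq by simp
    finally show ?thesis .
  qed
  have inj: "inj_on ((^) w) {..<q}"
  proof (rule linorder_inj_onI)
    fix k l assume "k < l" "k \<in> {..<q}" "l \<in> {..<q}"
    then show "w ^ k \<noteq> w ^ l"
      using eq[of k l] by (auto dest!: dvd_imp_le)
  qed auto
  define U where "U = (^) w ` {1..<q}"
  have card: "card U = q - 1"
    unfolding U_def by (subst card_image) (auto intro: inj_on_subset[OF inj])
  have U: "w ^ k \<in> U" if "\<not> q dvd k" for k
    unfolding U_def using that q mod[of k]
    by (intro image_eqI[of _ _ "k mod q"]) (auto simp: mod_greater_zero_iff_not_dvd Suc_le_eq)
  have U1: "u \<noteq> 1" if "u \<in> U" for u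
  proof -
    obtain k where "u = w ^ k" "0 < k" "k < q" using \<open>u \<in> U\<close> by (auto simp: U_def)
    then show ?thesis by (simp add: ord nat_dvd_not_less)
  qed
  let ?K = "{..<q} - {q div 2}"
  have "w ^ (2 * k + 1) \<in> U" if "k \<in> ?K" for k
  proof (rule U)
    show "\<not> q dvd 2 * k + 1"
      using that by (intro not_dvd_odd_number) (auto simp: \<open>odd q\<close>)
  qed
  then have sub: "(\<lambda>k. w ^ (2 * k + 1)) ` ?K \<subseteq> U" by auto
  have inj2: "inj_on (\<lambda>k. w ^ (2 * k + 1)) ?K"
  proof (rule linorder_inj_onI)
    fix k l assume kl: "k < l" "k \<in> ?K" "l \<in> ?K"
    show "w ^ (2 * k + 1) \<noteq> w ^ (2 * l + 1)"
    proof
      assume "w ^ (2 * k + 1) = w ^ (2 * l + 1)"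
      then have "q dvd 2 * (l - k)" using eq[of "2 * k + 1" "2 * l + 1"] kl by (simp add: right_diff_distrib')
      then have "q dvd l - k"
        using \<open>odd q\<close> by (simp add: coprime_dvd_mult_right_iff)
      then show False using kl by (auto dest!: dvd_imp_le)
    qed
  qed auto
  have cardK: "card ?K = q - 1" using q by (subst card_Diff_singleton) auto
  then have img: "(\<lambda>k. w ^ (2 * k + 1)) ` ?K = U"
    by (intro card_subset_eq sub) (simp_all only: card card_image[OF inj2] cardK, simp add: U_def)
  have inj3: "inj_on (\<lambda>u. u\<^sup>2) U"
  proof (rule inj_onI)
    fix u u' assume "u \<in> U" "u' \<in> U" and sq: "u\<^sup>2 = u'\<^sup>2"
    then have "u ^ q = 1" "u' ^ q = 1"
      by (auto simp: U_def ord simp flip: power_mult)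
    \<comment> \<open>Squaring is undone by raising to the power \<open>(q + 1) div 2\<close>, since
      \<open>q\<close> is odd.\<close>
    moreover have "x = (x\<^sup>2) ^ ((q + 1) div 2)" if "x ^ q = 1" for x :: 'a
    proof -
      have "(x\<^sup>2) ^ ((q + 1) div 2) = x ^ (q + 1)"
        using \<open>odd q\<close> by (simp only: power_mult [symmetric]) simp
      then show ?thesis by (simp add: that)
    qed
    ultimately show "u = u'" using sq by metis
  qed
  moreover have "(\<lambda>u. u\<^sup>2) ` U \<subseteq> U"
  proof clarsimp
    fix u assume "u \<in> U"
    then obtain k where k: "u = w ^ k" "0 < k" "k < q" by (auto simp: U_def)
    have "\<not> q dvd k * 2"
      using k \<open>odd q\<close> by (auto simp: coprime_dvd_mult_left_iff dest: dvd_imp_le)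
    then show "u\<^sup>2 \<in> U" using U[of "k * 2"] by (simp add: k(1) power_mult)
  qed
  ultimately have sq: "(\<lambda>u. u\<^sup>2) ` U = U"
    by (intro endo_inj_surj) (auto simp: U_def)
  have "(\<Prod>u\<in>U. 1 + u) * (\<Prod>u\<in>U. 1 - u) = (\<Prod>u\<in>U. 1 - u\<^sup>2)"
    by (simp add: prod.distrib [symmetric] algebra_simps power2_eq_square)
  also have "\<dots> = (\<Prod>u\<in>U. 1 - u)"
    using prod.reindex[OF inj3, of "\<lambda>u. 1 - u"] sq by simp
  \<comment> \<open>The product of the \<open>1 - u\<close> is nonzero because 1 is not in
    \<open>U\<close>, so it cancels.\<close>
  finally have "(\<Prod>u\<in>U. 1 + u) = 1"
    using U1 by (auto simp: U_def)
  then show ?thesis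
    using prod.reindex[OF inj2, of "\<lambda>u. 1 + u"] img by simp
qed

lemma sum_ln_norm_one_plus_odd_powers:
  fixes w :: complex
  assumes "odd q" and ord: "\<And>k. w ^ k = 1 \<longleftrightarrow> q dvd k"
  shows "(\<Sum>k\<in>{..<q} - {q div 2}. ln (norm (1 + w ^ (2 * k + 1)))) = 0"
proof -
  let ?K = "{..<q} - {q div 2}"
  have prod: "(\<Prod>k\<in>?K. 1 + w ^ (2 * k + 1)) = 1"
    by (rule prod_one_plus_odd_powers[OF assms])
  \<comment> \<open>A vanishing factor would contradict that the whole product is 1.\<close>
  have "1 + w ^ (2 * k + 1) \<noteq> 0" if "k \<in> ?K" for k
  proof
    assume "1 + w ^ (2 * k + 1) = 0"
    then have "(\<Prod>k\<in>?K. 1 + w ^ (2 * k + 1)) = 0"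
      using that by (intro prod_zero) auto
    with prod show False by simp
  qed
  then have "(\<Sum>k\<in>?K. ln (norm (1 + w ^ (2 * k + 1)))) = ln (\<Prod>k\<in>?K. norm (1 + w ^ (2 * k + 1)))"
    by (subst ln_prod) auto
  also have "\<dots> = 0"
    unfolding prod_norm prod by simp
  finally show ?thesis .
qed

section \<open>Real values and logarithms of the factors\<close>

definition numer :: "nat \<Rightarrow> nat \<Rightarrow> real \<Rightarrow> real" where
  "numer m n t = (real m)\<^sup>2 * (real n)\<^sup>2 * t ^ 4
     + (2 * (real m)\<^sup>2 * (real n)\<^sup>2 + 4 * real m * real n + 1) * t\<^sup>2 + (real m)\<^sup>2 * (real n)\<^sup>2"

text \<open>The contribution of one plane, with the denominator \<open>1 + t\<^sup>2\<close>
  included, as a real number. For \<open>z \<noteq> 1\<close> the middle coefficient is twice the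
  outer one, so the numerator is a multiple of \<open>(1 + t\<^sup>2)\<^sup>2\<close> and one power
  remains.\<close>

definition local_value :: "nat \<Rightarrow> nat \<Rightarrow> real \<Rightarrow> complex \<Rightarrow> real" where
  "local_value m n t z =
     (if z = 1 then numer m n t / (1 + t\<^sup>2)
      else (1 + t\<^sup>2) / ((norm (1 + inverse z ^ (2 * m * n)))\<^sup>2
        * (norm (1 + (inverse z ^ (2 * m * n)) ^ (2 * m)))\<^sup>2))"

lemma one_plus_square_pos: "0 < 1 + t\<^sup>2" for t :: real
  by (simp add: add_pos_nonneg)

lemma numer_pos:
  assumes "0 < m" "0 < n"
  shows "0 < numer m n t"
proof -
  have "0 < (real m)\<^sup>2 * (real n)\<^sup>2" using assms by simp
  moreover have "0 \<le> (real m)\<^sup>2 * (real n)\<^sup>2 * t ^ 4" by simp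
  moreover have "0 \<le> (2 * (real m)\<^sup>2 * (real n)\<^sup>2 + 4 * real m * real n + 1) * t\<^sup>2" by simp
  ultimately show ?thesis unfolding numer_def by linarith
qed

lemma one_plus_root_nonzero:
  fixes u :: complex
  assumes "odd q" "u ^ q = 1"
  shows "1 + u \<noteq> 0"
proof
  assume "1 + u = 0"
  then have "u = - 1" by (simp add: add_eq_0_iff)
  with assms show False by simp
qed

lemma inverse_root_power:
  fixes z :: complex
  assumes "z ^ q = 1"
  shows "(inverse z ^ k) ^ q = 1" "((inverse z ^ k) ^ l) ^ q = 1"
proof -
  show *: "(inverse z ^ k) ^ q = 1" for k
  proof -
    have "(z ^ k) ^ q = (z ^ q) ^ k" by (simp only: power_mult [symmetric] mult.commute)
    then show ?thesis by (simp add: power_inverse assms)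
  qed
  show "((inverse z ^ k) ^ l) ^ q = 1"
    using *[of "k * l"] by (simp add: power_mult)
qed

lemma local_value_pos:
  assumes "0 < m" "0 < n" and z: "z ^ (4 * m * n + 1) = 1"
  shows "0 < local_value m n t z"
proof -
  have "1 + inverse z ^ (2 * m * n) \<noteq> 0" "1 + (inverse z ^ (2 * m * n)) ^ (2 * m) \<noteq> 0"
    by (rule one_plus_root_nonzero[OF _ inverse_root_power(1)[OF z]], simp,
        rule one_plus_root_nonzero[OF _ inverse_root_power(2)[OF z]], simp)
  then show ?thesis
    using numer_pos[OF assms(1,2)] one_plus_square_pos[of t] by (simp add: local_value_def)
qed

lemma local_value:
  assumes "z ^ (4 * m * n + 1) = 1"
  shows "(outer_coeff m n z * (1 + of_real t ^ 4) + middle_coeff m n z * (of_real t)\<^sup>2) / (1 + (of_real t)\<^sup>2) =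
    complex_of_real (local_value m n t z)"
proof (cases "z = 1")
  case True
  then show ?thesis
    by (simp add: local_value_def numer_def outer_coeff_1 middle_coeff_1 algebra_simps power_mult_distrib)
next
  case False
  define W where "W = 1 / ((norm (1 + inverse z ^ (2 * m * n)))\<^sup>2
        * (norm (1 + (inverse z ^ (2 * m * n)) ^ (2 * m)))\<^sup>2)"
  have W: "outer_coeff m n z = of_real W" "middle_coeff m n z = 2 * of_real W"
    using coeffs_root_of_unity[OF assms False HOL.refl] by (simp_all only: W_def)
  have "W * (1 + t ^ 4) + 2 * W * t\<^sup>2 = W * (1 + t\<^sup>2) * (1 + t\<^sup>2)"
    by (simp add: algebra_simps power2_eq_square power4_eq_xxxx)
  then have "(W * (1 + t ^ 4) + 2 * W * t\<^sup>2) / (1 + t\<^sup>2) = W * (1 + t\<^sup>2)"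
    using one_plus_square_pos[of t] by simp
  moreover have "local_value m n t z = W * (1 + t\<^sup>2)"
    using False by (simp add: local_value_def W_def)
  ultimately have "local_value m n t z = (W * (1 + t ^ 4) + 2 * W * t\<^sup>2) / (1 + t\<^sup>2)"
    by simp
  then show ?thesis unfolding W by simp
qed

text \<open>At real \<open>t\<close> every plane contributes a positive real number. Hence the
  principal logarithm of the product is the real one and splits into a sum.\<close>

lemma (in metabelian_rep) Ln_twisted_alexander:
  assumes "0 < m" "0 < n"
  shows "Ln (rat_eval (twisted_alexander m n d (sigma d \<circ> \<rho>)) (of_real t)) =
    of_real (\<Sum>k<N. ln (local_value m n t (inverse a ^ (2 * k + 1))))"
proof -
  have "1 + (complex_of_real t)\<^sup>2 = of_real (1 + t\<^sup>2)" by simp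
  then have "1 + (complex_of_real t)\<^sup>2 \<noteq> 0"
    using one_plus_square_pos[of t] by (metis of_real_eq_0_iff less_irrefl)
  then have eval: "rat_eval (twisted_alexander m n d (sigma d \<circ> \<rho>)) (of_real t) =
      of_real (\<Prod>j<N. local_value m n t (eigval j))"
    by (simp add: rat_eval_twisted_alexander local_value[OF eigval_root] del: of_real_power)
  have pos: "0 < local_value m n t (eigval j)" for j
    by (rule local_value_pos[OF assms eigval_root])
  then have nz: "local_value m n t (eigval j) \<noteq> 0" for j
    by (simp add: less_imp_neq[symmetric])
  \<comment> \<open>Counting from the middle of the basis outwards makes the exponent independent of
    \<open>N\<close>, so the sums for varying \<open>N\<close> are partial sums of one
    sequence.\<close>
  have rev: "eigval (N - Suc k) = inverse a ^ (2 * k + 1)" if "k < N" for k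
  proof -
    have "2 * int (N - Suc k) - int (d - 1) = - int (2 * k + 1)" using that by auto
    then show ?thesis by (simp only: eigval_def power_int_minus power_int_of_nat power_inverse)
  qed
  have "Ln (of_real (\<Prod>j<N. local_value m n t (eigval j))) = of_real (ln (\<Prod>j<N. local_value m n t (eigval j)))"
    by (rule Ln_of_real) (intro prod_pos ballI pos)
  also have "ln (\<Prod>j<N. local_value m n t (eigval j)) = (\<Sum>j<N. ln (local_value m n t (eigval j)))"
    using nz by (intro ln_prod) auto
  also have "\<dots> = (\<Sum>k<N. ln (local_value m n t (eigval (N - Suc k))))"
    by (rule sum.nat_diff_reindex [symmetric])
  also have "\<dots> = (\<Sum>k<N. ln (local_value m n t (inverse a ^ (2 * k + 1))))"
    by (rule sum.cong) (simp_all only: rev lessThan_iff)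
  finally show ?thesis unfolding eval .
qed

section \<open>The sum over one period and the limit\<close>

lemma power_eq_1_iff_coprime:
  fixes a :: "'a::monoid_mult"
  assumes "\<And>k. a ^ k = 1 \<longleftrightarrow> q dvd k" "coprime q s"
  shows "(a ^ s) ^ k = 1 \<longleftrightarrow> q dvd k"
  using assms by (simp add: coprime_dvd_mult_right_iff flip: power_mult)

text \<open>The index \<open>q div 2\<close> carries the trivial eigenvalue and contributes
  \<open>numer m n t / (1 + t\<^sup>2)\<close>. At the other indices the norms are those of
  \<open>1 + u\<close> for odd powers \<open>u\<close> of \<open>w\<close> and of
  \<open>w ^ (2 * m)\<close>; both have order \<open>q\<close>, so these logarithms sum to 0. One
  \<open>ln (1 + t\<^sup>2)\<close> is then moved to complete the count \<open>q\<close>.\<close>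

lemma sum_ln_local_value:
  assumes mn: "0 < m" "0 < n" and a: "\<And>k. a ^ k = 1 \<longleftrightarrow> q dvd k" and q: "q dvd 4 * m * n + 1"
  shows "(\<Sum>k<q. ln (local_value m n t (inverse a ^ (2 * k + 1)))) =
    ln (numer m n t / (t\<^sup>2 + 1)\<^sup>2) + real q * ln (t\<^sup>2 + 1)"
proof -
  have "odd q" using dvd_trans[OF _ q, of 2] by auto
  then have "0 < q" by (auto intro: Nat.gr0I)
  \<comment> \<open>A common divisor divides \<open>4 * m * n + 1\<close> and twice
    \<open>2 * m * n\<close>, hence their difference 1. Coprimality keeps the order \<open>q\<close>
    when passing from \<open>a\<close> to \<open>w\<close> and to
    \<open>w ^ (2 * m)\<close>.\<close>
  have "coprime q (2 * m * n)"
  proof (rule coprimeI)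
    fix c assume c: "c dvd q" "c dvd 2 * m * n"
    then have "c dvd (4 * m * n + 1) - 2 * (2 * m * n)" using q by (intro dvd_diff_nat) (auto elim: dvd_trans)
    then show "is_unit c" by simp
  qed
  then have cop: "coprime q (2 * m * n)" "coprime q (2 * m)" by simp_all
  define w where "w = a ^ (2 * m * n)"
  have w: "w ^ k = 1 \<longleftrightarrow> q dvd k" for k
    unfolding w_def by (rule power_eq_1_iff_coprime[OF a cop(1)])
  have w': "(w ^ (2 * m)) ^ k = 1 \<longleftrightarrow> q dvd k" for k
    by (rule power_eq_1_iff_coprime[OF w cop(2)])
  let ?v = "\<lambda>k. ln (local_value m n t (inverse a ^ (2 * k + 1)))"
  let ?K = "{..<q} - {q div 2}"
  have v0: "?v (q div 2) = ln (numer m n t / (1 + t\<^sup>2))"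
  proof -
    have "2 * (q div 2) + 1 = q" using \<open>odd q\<close> by simp
    then have "inverse a ^ (2 * (q div 2) + 1) = 1"
      using a[of q] by (simp only: power_inverse) simp
    then show ?thesis by (simp only: local_value_def if_True simp_thms)
  qed
  have v: "?v k = ln (1 + t\<^sup>2) - 2 * ln (norm (1 + w ^ (2 * k + 1)))
      - 2 * ln (norm (1 + (w ^ (2 * m)) ^ (2 * k + 1)))" if "k \<in> ?K" for k
  proof -
    have "\<not> q dvd 2 * k + 1" using that \<open>odd q\<close> by (intro not_dvd_odd_number) auto
    then have "inverse a ^ (2 * k + 1) \<noteq> 1"
      using a[of "2 * k + 1"] by (simp only: power_inverse inverse_eq_1_iff not_False_eq_True)
    moreover have inv: "inverse (inverse a ^ (2 * k + 1)) ^ (2 * m * n) = w ^ (2 * k + 1)"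
      unfolding power_inverse inverse_inverse_eq w_def by (simp only: power_mult [symmetric] mult.commute)
    moreover have "(w ^ (2 * k + 1)) ^ (2 * m) = (w ^ (2 * m)) ^ (2 * k + 1)"
      by (simp only: power_mult [symmetric] mult.commute)
    ultimately have "local_value m n t (inverse a ^ (2 * k + 1)) =
        (1 + t\<^sup>2) / ((norm (1 + w ^ (2 * k + 1)))\<^sup>2 * (norm (1 + (w ^ (2 * m)) ^ (2 * k + 1)))\<^sup>2)"
      by (simp only: local_value_def if_False)
    moreover have "norm (1 + w ^ (2 * k + 1)) > 0" "norm (1 + (w ^ (2 * m)) ^ (2 * k + 1)) > 0"
    proof -
      have "(w ^ (2 * k + 1)) ^ q = 1" "((w ^ (2 * m)) ^ (2 * k + 1)) ^ q = 1"
        by (simp_all only: power_mult [symmetric] w) simp_all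
      then show "norm (1 + w ^ (2 * k + 1)) > 0" "norm (1 + (w ^ (2 * m)) ^ (2 * k + 1)) > 0"
        using one_plus_root_nonzero[OF \<open>odd q\<close>] by (simp_all only: zero_less_norm_iff not_False_eq_True)
    qed
    ultimately show ?thesis
      using one_plus_square_pos[of t] by (simp add: ln_div ln_mult ln_realpow)
  qed
  have rest: "(\<Sum>k\<in>?K. ?v k) = real (q - 1) * ln (1 + t\<^sup>2)"
  proof -
    have "(\<Sum>k\<in>?K. ?v k) = (\<Sum>k\<in>?K. ln (1 + t\<^sup>2)
        - 2 * ln (norm (1 + w ^ (2 * k + 1))) - 2 * ln (norm (1 + (w ^ (2 * m)) ^ (2 * k + 1))))"
      by (rule sum.cong[OF HOL.refl v])
    also have "\<dots> = (\<Sum>k\<in>?K. ln (1 + t\<^sup>2))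
        - 2 * (\<Sum>k\<in>?K. ln (norm (1 + w ^ (2 * k + 1))))
        - 2 * (\<Sum>k\<in>?K. ln (norm (1 + (w ^ (2 * m)) ^ (2 * k + 1))))"
      by (simp only: sum_subtractf sum_distrib_left)
    also have "\<dots> = real (q - 1) * ln (1 + t\<^sup>2)"
      unfolding sum_ln_norm_one_plus_odd_powers[OF \<open>odd q\<close> w]
        sum_ln_norm_one_plus_odd_powers[OF \<open>odd q\<close> w']
      using \<open>0 < q\<close> by (simp add: card_Diff_singleton)
    finally show ?thesis .
  qed
  have "(\<Sum>k<q. ?v k) = ?v (q div 2) + (\<Sum>k\<in>?K. ?v k)"
    using \<open>0 < q\<close> by (intro sum.remove) auto
  then have "(\<Sum>k<q. ?v k) = ln (numer m n t / (1 + t\<^sup>2)) + real (q - 1) * ln (1 + t\<^sup>2)"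
    by (simp only: v0 rest)
  moreover have "ln (numer m n t / (1 + t\<^sup>2)) = ln (numer m n t) - ln (1 + t\<^sup>2)"
    "ln (numer m n t / (t\<^sup>2 + 1)\<^sup>2) = ln (numer m n t) - 2 * ln (1 + t\<^sup>2)"
    using numer_pos[OF mn, of t] one_plus_square_pos[of t]
    by (simp_all add: ln_div ln_realpow add.commute[of "t\<^sup>2"])
  moreover have "real (q - 1) = real q - 1"
    using \<open>0 < q\<close> by simp
  ultimately show ?thesis
    by (simp add: add.commute[of "t\<^sup>2"] algebra_simps)
qed

text \<open>As \<xi> is a primitive \<open>k\<close>-th root of unity, the power is 1 exactly when
  \<open>k\<close> divides \<open>i * l\<close>; cancelling the gcd leaves a coprime factor of
  \<open>l\<close>. So \<open>q\<close> in the theorem is the exact order of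
  \<open>\<xi> ^ i\<close>.\<close>

lemma xi_power_eq_1_iff:
  assumes "0 < k" "\<xi> = exp (2 * of_real pi * \<i> / of_nat k)"
  shows "(\<xi> ^ i) ^ l = 1 \<longleftrightarrow> k div gcd k i dvd l"
proof -
  have "(\<xi> ^ i) ^ l = exp (2 * of_real pi * \<i> * of_nat (i * l) / of_nat k)"
    unfolding assms(2) power_mult [symmetric] exp_of_nat_mult [symmetric]
    by (simp add: mult_ac)
  then have "(\<xi> ^ i) ^ l = 1 \<longleftrightarrow> k dvd i * l"
    using complex_root_unity_eq_1[of k "i * l"] assms(1) by simp
  also have "\<dots> \<longleftrightarrow> k div gcd k i dvd l"
  proof -
    have "gcd k i \<noteq> 0" using assms(1) by simp
    then obtain k' i' where k': "k = k' * gcd k i" and i': "i = i' * gcd k i" and cop: "coprime k' i'"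
      using gcd_coprime_exists by blast
    have "k div gcd k i = k'" using k' \<open>gcd k i \<noteq> 0\<close> by (metis nonzero_mult_div_cancel_right)
    moreover have "k dvd i * l \<longleftrightarrow> gcd k i * k' dvd gcd k i * (i' * l)"
      by (subst (1) k', subst (2) i') (simp only: mult_ac)
    ultimately show ?thesis
      using assms(1) cop by (auto simp: coprime_dvd_mult_right_iff)
  qed
  finally show ?thesis .
qed

theorem theorem4p6:
  fixes m n i q :: nat and \<xi> :: complex and t :: real
    and \<rho> :: "lin_gen word set \<Rightarrow> complex mat"
  assumes "0 < m" and "0 < n"
    and "1 \<le> i" and "i \<le> 2 * m * n"
    and "\<xi> = exp (2 * of_real pi * \<i> / of_nat (4 * m * n + 1))"
    and "\<rho> \<in> hom (knot_group m n) (SL 2)"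
    and "\<rho> (knot_gen m n X1) = mat2 (\<xi> ^ i) 0 0 (\<xi> powi (- int i))"
    and "\<rho> (knot_gen m n X2) = mat2 (\<xi> ^ (2 * m * i)) 0 0 (\<xi> powi (- int (2 * m * i)))"
    and "\<rho> (knot_gen m n Mu) = mat2 0 1 (- 1) 0"
    and "q = (4 * m * n + 1) div gcd (4 * m * n + 1) i"
  shows "(\<lambda>N. Ln (rat_eval (twisted_alexander m n (2 * N) (sigma (2 * N) \<circ> \<rho>)) (of_real t))
            / of_nat (2 * N))
    \<longlonglongrightarrow> of_real
         (1 / (2 * real q) *
            ln (((real m)\<^sup>2 * (real n)\<^sup>2 * t ^ 4
                 + (2 * (real m)\<^sup>2 * (real n)\<^sup>2 + 4 * real m * real n + 1) * t\<^sup>2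
                 + (real m)\<^sup>2 * (real n)\<^sup>2) / (t\<^sup>2 + 1)\<^sup>2)
          + 1 / 2 * ln (t\<^sup>2 + 1))"
proof -
  define a where "a = \<xi> ^ i"
  have a: "a ^ k = 1 \<longleftrightarrow> q dvd k" for k
    unfolding a_def assms(10) by (rule xi_power_eq_1_iff[OF _ assms(5)]) simp
  have q: "q dvd 4 * m * n + 1"
    unfolding assms(10) by (rule dvdI[where k = "gcd (4 * m * n + 1) i"]) simp
  then have "0 < q" by (auto intro: Nat.gr0I)
  have rep: "metabelian_rep m n a \<rho>"
  proof
    show "a ^ (4 * m * n + 1) = 1" using a[of "4 * m * n + 1"] q by (simp only:)
    have "\<xi> ^ (2 * m * i) = a ^ (2 * m)"
      unfolding a_def by (simp only: power_mult [symmetric] mult.commute)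
    then show "\<rho> (knot_gen m n X2) = mat2 (a ^ (2 * m)) 0 0 (inverse (a ^ (2 * m)))"
      using assms(8) by (simp only: power_int_minus power_int_of_nat)
    show "\<rho> (knot_gen m n X1) = mat2 a 0 0 (inverse a)"
      using assms(7) by (simp only: a_def power_int_minus power_int_of_nat)
  qed (fact assms)+
  define u where "u k = ln (local_value m n t (inverse a ^ (2 * k + 1)))" for k
  have "inverse a ^ (2 * (k + q) + 1) = inverse a ^ (2 * k + 1)" for k
  proof -
    have "inverse a ^ q = 1" using a[of q] by (simp add: power_inverse)
    moreover have "2 * (k + q) + 1 = (2 * k + 1) + q * 2" by simp
    ultimately show ?thesis by (simp only: power_add [of _ "2 * k + 1"] power_mult [of _ q] power_one mult_1_right)
  qed
  then have "u (k + q) = u k" for k by (simp only: u_def)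
  then have "(\<lambda>N. (\<Sum>k<N. u k) / real N) \<longlonglongrightarrow> (\<Sum>k<q. u k) / real q"
    by (rule periodic_average_tendsto[OF \<open>0 < q\<close>])
  \<comment> \<open>The factor one half appears because there are \<open>N\<close> planes but the
    logarithm is divided by the dimension \<open>2 * N\<close>.\<close>
  then have lim: "(\<lambda>N. complex_of_real (1 / 2 * ((\<Sum>k<N. u k) / real N)))
      \<longlonglongrightarrow> of_real (1 / 2 * ((\<Sum>k<q. u k) / real q))"
    by (intro tendsto_of_real tendsto_mult_left)
  \<comment> \<open>The sequences agree also at \<open>N = 0\<close>, where both quotients have
    denominator 0 and hence the value 0.\<close>
  have "(\<lambda>N. complex_of_real (1 / 2 * ((\<Sum>k<N. u k) / real N))) =
      (\<lambda>N. Ln (rat_eval (twisted_alexander m n (2 * N) (sigma (2 * N) \<circ> \<rho>)) (of_real t)) / of_nat (2 * N))"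
    unfolding metabelian_rep.Ln_twisted_alexander[OF rep assms(1,2)] u_def [symmetric] by simp
  moreover have "1 / 2 * ((\<Sum>k<q. u k) / real q) =
      1 / (2 * real q) * ln (numer m n t / (t\<^sup>2 + 1)\<^sup>2) + 1 / 2 * ln (t\<^sup>2 + 1)"
  proof -
    have avg: "1 / 2 * ((L + Q * M) / Q) = 1 / (2 * Q) * L + 1 / 2 * M" if "Q \<noteq> 0" for L M Q :: real
      using that by (simp add: add_divide_distrib)
    show ?thesis
      unfolding u_def sum_ln_local_value[OF assms(1,2) a q] by (rule avg) (use \<open>0 < q\<close> in simp)
  qed
  ultimately show ?thesis
    using lim unfolding numer_def by (simp only:)
qed

end
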